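(* Let $n_1,\ldots,n_m\in S^2$ be labelled directions, no two of which are parallel or antiparallel, and let $\Gamma$ be their correlation graph. Assume that $T(\Gamma)=C(\Gamma)$. Then the labelled pair data $$\{I_2(n_i,n_j):1\le i<j\le m\}$$ together with the labelled triple data $$\{I_3(n_i,n_j,n_k):1\le i<j<k\le m\}$$ determine the direction family up to transformations $$n_i\mapsto\varepsilon_iQn_i,\qquad\varepsilon_i\in\{\pm1\},\ Q\in O(3);$$ that is, any labelled family in $S^2$ with the same labelled pair and triple data is of the form $(\varepsilon_iQn_i)_{i=1}^m$. Equivalently, the pair and triple data determine the Gram matrix $G=(n_i\cdot n_j)_{i,j}$ uniquely up to diagonal sign conjugacy $G\mapsto D_\varepsilon GD_\varepsilon$, $D_\varepsilon=\operatorname{diag}(\varepsilon_1,\ldots,\varepsilon_m)$, $\varepsilon\in\{\pm1\}^m$. If the correlation graph is complete, it is enough to use the triples containing one fixed reference direction: choosing the reference index $1$, the pair data together with $$\{I_3(n_1,n_i,n_j):2\le i<j\le m\}$$ already determine the configuration (in the same sense). A complete nonorthogonal configuration therefore requires only $$\binom m2+\binom{m-1}2=(m-1)^2$$ nontrivial labelled pair and triple values.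
   Context: For $n_1,\ldots,n_k\in S^2$, $I_k(n_1,\ldots,n_k)=\mathbb{E}\prod_{j=1}^k|U\cdot n_j|$ with $U$ uniformly distributed on $S^2$. The correlation graph $\Gamma$ of $n_1,\ldots,n_m$ has vertex set $\{1,\ldots,m\}$ and an edge $ij$ ($i\ne j$) exactly when $n_i\cdot n_j\ne0$. $C(\Gamma)$ is the cycle space of $\Gamma$ over $\mathbb{F}_2$ and $T(\Gamma)\subseteq C(\Gamma)$ is the subspace generated by the triangles (3-cycles) of $\Gamma$. *)

theory Defs
  imports "HOL-Probability.Probability" "HOL-Library.Function_Algebras" "HOL-Library.Z2"
begin

text \<open>
  The uniform distribution on the unit sphere of Euclidean 3-space is rendered as the normalised
  cone measure: the law of the direction of a uniformly distributed point of the unit ball.  The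
  lemmas below record that it is a rotation-invariant probability measure carried by the sphere.
\<close>

definition uniform_S2 :: "(real^3) measure" where
  "uniform_S2 = distr (uniform_measure lborel (ball 0 1)) borel (\<lambda>x. x /\<^sub>R norm x)"

lemma emeasure_unit_ball:
  "emeasure lborel (ball (0::real^3) 1) \<noteq> 0" "emeasure lborel (ball (0::real^3) 1) \<noteq> \<infinity>"
  using content_ball_pos[of 1 "0::real^3"] emeasure_lborel_ball_finite[of "0::real^3" 1]
  by (auto simp: measure_def)

lemma prob_space_uniform_S2: "prob_space uniform_S2"
  unfolding uniform_S2_def
  by (rule prob_space.prob_space_distr[OF prob_space_uniform_measure])
     (use emeasure_unit_ball in auto)

lemma AE_uniform_S2: "AE u in uniform_S2. u \<in> sphere 0 1"
proof -
  have "AE x in lborel. x \<noteq> (0::real^3)"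
    by (rule AE_lborel_singleton)
  then have "AE x in uniform_measure lborel (ball 0 1). x \<noteq> (0::real^3)"
    using emeasure_unit_ball by (subst AE_uniform_measure) (auto simp: less_top)
  then have "AE x in uniform_measure lborel (ball 0 1). x /\<^sub>R norm x \<in> sphere (0::real^3) 1"
    by eventually_elim simp
  then show ?thesis
    unfolding uniform_S2_def by (subst AE_distr_iff) auto
qed

lemma distr_lborel_orthogonal:
  fixes Q :: "real^3^3"
  assumes Q: "orthogonal_matrix Q"
  shows "distr lborel borel ((*v) Q) = lborel"
proof (rule lborel_eqI [symmetric])
  have R: "orthogonal_matrix (transpose Q)"
    using Q by (simp add: orthogonal_matrix_transpose)
  have meas: "(*v) Q \<in> borel_measurable lborel"
    by (simp add: borel_measurable_continuous_onI matrix_vector_mult_linear_continuous_on)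
  fix l u :: "real^3"
  assume lu: "\<And>b. b \<in> Basis \<Longrightarrow> l \<bullet> b \<le> u \<bullet> b"
  have vim: "(*v) Q -` box l u = (*v) (transpose Q) ` box l u"
  proof (intro set_eqI iffI)
    fix x assume "x \<in> (*v) Q -` box l u"
    moreover have "x = transpose Q *v (Q *v x)"
      using Q by (simp add: orthogonal_matrix matrix_vector_mul_assoc)
    ultimately show "x \<in> (*v) (transpose Q) ` box l u"
      by blast
  next
    fix x assume "x \<in> (*v) (transpose Q) ` box l u"
    moreover have "Q *v (transpose Q *v y) = y" for y
      using Q by (simp only: orthogonal_matrix_def matrix_vector_mul_assoc matrix_vector_mul_lid)
    ultimately show "x \<in> (*v) Q -` box l u"
      by auto
  qed
  have T: "orthogonal_transformation ((*v) (transpose Q))"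
    using R by (simp add: orthogonal_transformation_matrix)
  have "(*v) Q -` box l u \<in> sets borel"
    using measurable_sets[OF meas, of "box l u"] by simp
  then have m: "(*v) (transpose Q) ` box l u \<in> sets borel"
    by (simp add: vim)
  have lm: "(*v) (transpose Q) ` box l u \<in> lmeasurable"
    by (rule measurable_orthogonal_image[OF T lmeasurable_box])
  have "emeasure (distr lborel borel ((*v) Q)) (box l u)
      = emeasure lebesgue ((*v) (transpose Q) ` box l u)"
    using meas m by (simp add: emeasure_distr vim)
  also have "\<dots> = measure lebesgue ((*v) (transpose Q) ` box l u)"
    by (rule emeasure_eq_measure2[OF lm])
  also have "\<dots> = ennreal (measure lebesgue (box l u))"
    by (rule arg_cong[where f = ennreal], rule measure_orthogonal_image[OF T lmeasurable_box])
  also have "\<dots> = emeasure lebesgue (box l u)"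
    by (rule emeasure_eq_measure2[OF lmeasurable_box, symmetric])
  also have "\<dots> = (\<Prod>b\<in>Basis. (u - l) \<bullet> b)"
    using lu by (simp add: emeasure_lborel_box)
  finally show "emeasure (distr lborel borel ((*v) Q)) (box l u) = (\<Prod>b\<in>Basis. (u - l) \<bullet> b)" .
qed simp

lemma uniform_S2_rotation_invariant:
  fixes Q :: "real^3^3"
  assumes Q: "orthogonal_matrix Q"
  shows "distr uniform_S2 borel ((*v) Q) = uniform_S2"
proof -
  let ?B = "uniform_measure lborel (ball (0::real^3) 1)"
  let ?p = "\<lambda>x::real^3. x /\<^sub>R norm x"
  have n: "norm (Q *v x) = norm x" for x
    using Q by (metis orthogonal_transformation_norm orthogonal_transformation_matrix matrix_of_matrix_vector_mul matrix_vector_mul_linear)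
  have meas [measurable]: "(*v) Q \<in> borel_measurable borel"
    by (simp add: borel_measurable_continuous_onI matrix_vector_mult_linear_continuous_on)
  have B: "distr ?B borel ((*v) Q) = ?B"
  proof (rule measure_eqI)
    fix A assume "A \<in> sets (distr ?B borel ((*v) Q))"
    then have A [measurable]: "A \<in> sets borel" by simp
    have m: "(*v) Q -` A \<in> sets borel"
      using measurable_sets[OF meas A] by simp
    have "emeasure lborel (ball 0 1 \<inter> (*v) Q -` A) = emeasure lborel ((*v) Q -` (ball 0 1 \<inter> A))"
      by (rule arg_cong[where f = "emeasure lborel"]) (auto simp: n)
    also have "\<dots> = emeasure (distr lborel borel ((*v) Q)) (ball 0 1 \<inter> A)"
      by (subst emeasure_distr) auto
    finally show "emeasure (distr ?B borel ((*v) Q)) A = emeasure ?B A"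
      using m by (simp add: emeasure_distr distr_lborel_orthogonal[OF Q])
  qed simp
  have "distr uniform_S2 borel ((*v) Q) = distr ?B borel ((*v) Q \<circ> ?p)"
    unfolding uniform_S2_def by (subst distr_distr) auto
  also have "(*v) Q \<circ> ?p = ?p \<circ> (*v) Q"
    by (auto simp: fun_eq_iff n matrix_vector_mult_scaleR)
  also have "distr ?B borel (?p \<circ> (*v) Q) = distr (distr ?B borel ((*v) Q)) borel ?p"
    by (subst distr_distr) auto
  finally show ?thesis
    by (simp only: B uniform_S2_def)
qed

definition abs_moment :: "(real^3) list \<Rightarrow> real" where
  "abs_moment ns = (\<integral>u. (\<Prod>n\<leftarrow>ns. \<bar>u \<bullet> n\<bar>) \<partial>uniform_S2)"

definition corr_edges :: "nat \<Rightarrow> (nat \<Rightarrow> real^3) \<Rightarrow> nat set set" where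
  "corr_edges m n = {{i, j} | i j. i \<in> {1..m} \<and> j \<in> {1..m} \<and> i \<noteq> j \<and> n i \<bullet> n j \<noteq> 0}"

text \<open>
  Graphs are given by a finite vertex set and a set of two-element edges.  Edge sets are vectors
  over the two-element field, i.e. functions from potential edges to \<^typ>\<open>bit\<close>.
\<close>

definition edge_scale :: "bit \<Rightarrow> (nat set \<Rightarrow> bit) \<Rightarrow> nat set \<Rightarrow> bit" where
  "edge_scale c x = (\<lambda>e. c * x e)"

global_interpretation edge_space: vector_space edge_scale
  by unfold_locales (simp_all only: edge_scale_def fun_eq_iff plus_fun_apply distrib_left distrib_right mult.assoc mult_1_left simp_thms)

definition edge_vec :: "nat set set \<Rightarrow> nat set \<Rightarrow> bit" where
  "edge_vec F e = of_bool (e \<in> F)"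

text \<open>The kernel of the boundary map: edge vectors in which every vertex has even degree.\<close>

definition cycle_space :: "nat set \<Rightarrow> nat set set \<Rightarrow> (nat set \<Rightarrow> bit) set" where
  "cycle_space V E =
     {x. (\<forall>e. e \<notin> E \<longrightarrow> x e = 0) \<and> (\<forall>v\<in>V. (\<Sum>e | e \<in> E \<and> v \<in> e. x e) = 0)}"

definition triangles :: "nat set set \<Rightarrow> nat set set set" where
  "triangles E = {{{a, b}, {b, c}, {a, c}} | a b c.
     a \<noteq> b \<and> b \<noteq> c \<and> a \<noteq> c \<and> {a, b} \<in> E \<and> {b, c} \<in> E \<and> {a, c} \<in> E}"

definition triangle_space :: "nat set set \<Rightarrow> (nat set \<Rightarrow> bit) set" where
  "triangle_space E = edge_space.span (edge_vec ` triangles E)"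

lemma subspace_cycle_space: "edge_space.subspace (cycle_space V E)"
proof (rule edge_space.subspaceI)
  fix x y assume "x \<in> cycle_space V E" "y \<in> cycle_space V E"
  then show "x + y \<in> cycle_space V E"
    by (simp add: cycle_space_def sum.distrib del: add_bit_eq_xor)
next
  fix c x assume "x \<in> cycle_space V E"
  then show "edge_scale c x \<in> cycle_space V E"
    by (cases c) (simp_all add: cycle_space_def edge_scale_def del: mult_bit_eq_and)
qed (simp add: cycle_space_def)

lemma triangle_space_subset_cycle_space:
  assumes "finite V" "E \<subseteq> Pow V"
  shows "triangle_space E \<subseteq> cycle_space V E"
  unfolding triangle_space_def
proof (rule edge_space.span_minimal[OF _ subspace_cycle_space], clarify)
  fix t assume "t \<in> triangles E"
  then obtain a b c where t: "t = {{a, b}, {b, c}, {a, c}}"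
    and ne: "a \<noteq> b" "b \<noteq> c" "a \<noteq> c" and E: "t \<subseteq> E"
    by (auto simp: triangles_def)
  have fin: "finite E"
    using assms finite_subset by blast
  have "(\<Sum>e | e \<in> E \<and> v \<in> e. edge_vec t e) = 0" for v
  proof -
    have "(\<Sum>e | e \<in> E \<and> v \<in> e. edge_vec t e) = (\<Sum>e\<in>{e\<in>t. v \<in> e}. 1)"
      using fin E by (intro sum.mono_neutral_cong_right) (auto simp: edge_vec_def)
    also have "{e\<in>t. v \<in> e} = (if v = a then {{a, b}, {a, c}} else if v = b then {{a, b}, {b, c}}
        else if v = c then {{b, c}, {a, c}} else {})"
      using ne unfolding t by auto
    also have "(\<Sum>e\<in>\<dots>. (1::bit)) = 0"
      using ne by (auto simp: doubleton_eq_iff)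
    finally show ?thesis .
  qed
  moreover have "edge_vec t e = 0" if "e \<notin> E" for e
    using that E by (auto simp: edge_vec_def)
  ultimately show "edge_vec t \<in> cycle_space V E"
    by (simp add: cycle_space_def)
qed

text \<open>Labels of data values: the list \<open>[i, j, ...]\<close> stands for the moment of \<open>n i, n j, ...\<close>.\<close>

definition pair_labels :: "nat \<Rightarrow> nat list set" where
  "pair_labels m = {[i, j] | i j. 1 \<le> i \<and> i < j \<and> j \<le> m}"

definition triple_labels :: "nat \<Rightarrow> nat list set" where
  "triple_labels m = {[i, j, k] | i j k. 1 \<le> i \<and> i < j \<and> j < k \<and> k \<le> m}"

definition ref_triple_labels :: "nat \<Rightarrow> nat list set" where
  "ref_triple_labels m = {[1, i, j] | i j. 2 \<le> i \<and> i < j \<and> j \<le> m}"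

definition same_data :: "nat list set \<Rightarrow> (nat \<Rightarrow> real^3) \<Rightarrow> (nat \<Rightarrow> real^3) \<Rightarrow> bool" where
  "same_data L n n' \<longleftrightarrow> (\<forall>l\<in>L. abs_moment (map n l) = abs_moment (map n' l))"

definition sign_family :: "nat \<Rightarrow> (nat \<Rightarrow> real) \<Rightarrow> bool" where
  "sign_family m \<epsilon> \<longleftrightarrow> (\<forall>i\<in>{1..m}. \<epsilon> i \<in> {1, -1})"

definition same_config :: "nat \<Rightarrow> (nat \<Rightarrow> real^3) \<Rightarrow> (nat \<Rightarrow> real^3) \<Rightarrow> bool" where
  "same_config m n n' \<longleftrightarrow>
     (\<exists>\<epsilon> (Q::real^3^3). sign_family m \<epsilon> \<and> orthogonal_matrix Q \<and>
        (\<forall>i\<in>{1..m}. n' i = \<epsilon> i *\<^sub>R (Q *v n i)))"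

definition gram :: "(nat \<Rightarrow> real^3) \<Rightarrow> nat \<Rightarrow> nat \<Rightarrow> real" where
  "gram n i j = n i \<bullet> n j"

text \<open>Entry \<open>(i, j)\<close> of \<open>D G D\<close> with \<open>D = diag(\<epsilon> 1, ..., \<epsilon> m)\<close> is \<open>\<epsilon> i * G i j * \<epsilon> j\<close>.\<close>

definition sign_conjugate :: "nat \<Rightarrow> (nat \<Rightarrow> nat \<Rightarrow> real) \<Rightarrow> (nat \<Rightarrow> nat \<Rightarrow> real) \<Rightarrow> bool" where
  "sign_conjugate m G G' \<longleftrightarrow>
     (\<exists>\<epsilon>. sign_family m \<epsilon> \<and> (\<forall>i\<in>{1..m}. \<forall>j\<in>{1..m}. G' i j = \<epsilon> i * G i j * \<epsilon> j))"

end

theory Submission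
  imports Defs
begin

text \<open>
  Integrating a homogeneous function against a radial weight separates the radial part, so a moment
  on the sphere is, up to a factor depending only on the number of directions, the corresponding
  moment of a standard Gaussian vector \<open>X\<close>.  Write \<open>\<kappa> \<bar>t\<bar>\<close> as the integral of
  \<open>(1 - cos (a t)) / a\<^sup>2\<close> over \<open>a\<close>.  By Tonelli the Gaussian moments become integrals of
  expectations of products of cosines, which are explicit: a pair contributes
  \<open>cosh (a b z)\<close> with \<open>z = u \<bullet> v\<close>, increasing in \<open>\<bar>z\<bar>\<close>, and a triple
  contributes \<open>cosh P cosh Q cosh R - sinh P sinh Q sinh R\<close> with
  \<open>P Q R = (a b c)\<^sup>2 (u \<bullet> v) (u \<bullet> w) (v \<bullet> w)\<close>.  Hence pair data determine the
  absolute Gram entries, and triple data the sign of the product of the entries around a triangle,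
  as the integrands of two candidates of opposite sign differ by a function that is positive
  off the coordinate planes \<open>a b c = 0\<close>.

  The ratio of the signs of two Gram matrices is then a 0/1 function on edges that sums to
  zero over triangles, hence over all cycles, hence is a coboundary; its potential is the diagonal
  sign family.
\<close>

section \<open>Radial integration and the Gaussian measure\<close>

lemma nn_integral_lborel_scale:
  fixes f :: "'a::euclidean_space \<Rightarrow> ennreal"
  assumes [measurable]: "f \<in> borel_measurable borel" and "c > 0"
  shows "(\<integral>\<^sup>+x. f x \<partial>lborel) = ennreal (c ^ DIM('a)) * (\<integral>\<^sup>+x. f (c *\<^sub>R x) \<partial>lborel)"
  using assms(2)
  by (subst lborel_affine[of c 0])
     (simp_all add: nn_integral_density nn_integral_distr nn_integral_cmult)

text \<open>A weight of the norm separates from a function invariant under positive scaling. Both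
  sides integrate \<open>\<phi>\<close> against the image under \<open>norm\<close> of a measure on
  the space. Rescaling by \<open>s\<close> shows that the two images agree on every half-line
  \<open>{..<s}\<close>, and these generate the Borel sets. The identity is cross-multiplied to
  avoid division.\<close>

lemma nn_integral_radial_mult:
  fixes H :: "'a::euclidean_space \<Rightarrow> ennreal" and \<phi> :: "real \<Rightarrow> ennreal"
  assumes H [measurable]: "H \<in> borel_measurable borel" and \<phi> [measurable]: "\<phi> \<in> borel_measurable borel"
    and hom: "\<And>c x. c > 0 \<Longrightarrow> H (c *\<^sub>R x) = H x"
    and fin: "(\<integral>\<^sup>+x. H x * indicator (ball 0 1) x \<partial>lborel) < \<infinity>"
  shows "emeasure lborel (ball (0::'a) 1) * (\<integral>\<^sup>+x. \<phi> (norm x) * H x \<partial>lborel)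
    = (\<integral>\<^sup>+x. H x * indicator (ball 0 1) x \<partial>lborel) * (\<integral>\<^sup>+x. \<phi> (norm (x::'a)) \<partial>lborel)"
proof -
  let ?v = "emeasure lborel (ball (0::'a) 1)"
  let ?C = "\<integral>\<^sup>+x. H x * indicator (ball 0 1) x \<partial>lborel"
  define M N where "M = distr (density lborel (\<lambda>x. ?v * H x)) borel norm"
    and "N = distr (density lborel (\<lambda>x::'a. ?C)) borel norm"
  have v: "?v = (\<integral>\<^sup>+x. indicator (ball (0::'a) 1) x \<partial>lborel)"
    by simp
  have v_fin: "?v < \<infinity>"
    using emeasure_lborel_ball_finite[of "0::'a" 1] by (simp add: less_top)
  have *: "emeasure M {..<s} = ?v * (ennreal (s ^ DIM('a)) * ?C)"
    "emeasure N {..<s} = ?C * (ennreal (s ^ DIM('a)) * ?v)" if s: "s > 0" for s :: real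
  proof -
    have ind: "indicator {..<s} (norm (s *\<^sub>R x)) = (indicator (ball 0 1) x :: ennreal)" for x :: 'a
      using s by (auto simp: indicator_def)
    have "emeasure M {..<s} = (\<integral>\<^sup>+x. indicator {..<s} x \<partial>M)"
      by (simp add: M_def)
    also have "\<dots> = (\<integral>\<^sup>+x. ?v * (H x * indicator {..<s} (norm x)) \<partial>lborel)"
      unfolding M_def by (subst nn_integral_distr) (simp_all add: nn_integral_density mult.assoc)
    also have "\<dots> = ?v * (\<integral>\<^sup>+x. H x * indicator {..<s} (norm x) \<partial>lborel)"
      by (rule nn_integral_cmult) simp
    finally show "emeasure M {..<s} = ?v * (ennreal (s ^ DIM('a)) * ?C)"
      using s by (subst (asm) nn_integral_lborel_scale[of _ s]) (simp_all only: ind hom, simp_all)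
    have "emeasure N {..<s} = (\<integral>\<^sup>+x. indicator {..<s} x \<partial>N)"
      by (simp add: N_def)
    also have "\<dots> = (\<integral>\<^sup>+x. ?C * indicator {..<s} (norm (x::'a)) \<partial>lborel)"
      unfolding N_def by (subst nn_integral_distr) (simp_all add: nn_integral_density)
    also have "\<dots> = ?C * (\<integral>\<^sup>+x. indicator {..<s} (norm (x::'a)) \<partial>lborel)"
      by (rule nn_integral_cmult) simp
    finally show "emeasure N {..<s} = ?C * (ennreal (s ^ DIM('a)) * ?v)"
      using s by (subst (asm) nn_integral_lborel_scale[of _ s]) (simp_all only: ind v, simp_all)
  qed
  have "M = N"
  proof (rule measure_eqI_generator_eq[where E = "range lessThan" and A = "\<lambda>i. {..<real i}"])
    have "{..<a} \<inter> {..<b} = {..<min a b}" for a b :: real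
      by auto
    then show "Int_stable (range (lessThan :: real \<Rightarrow> _))"
      by (auto simp: Int_stable_def)
    fix X :: "real set" assume "X \<in> range lessThan"
    then obtain s where X: "X = {..<s}" by auto
    show "emeasure M X = emeasure N X"
    proof (cases "s > 0")
      case True
      then show ?thesis by (simp add: X * mult_ac)
    next
      case False
      then have "norm -` {..<s} = ({} :: 'a set)"
        by (auto simp: not_less dest: le_less_trans[OF norm_ge_zero])
      then show ?thesis by (simp add: X M_def N_def emeasure_distr)
    qed
  next
    have "\<exists>i. x < real i" for x
      by (rule reals_Archimedean2)
    then show "(\<Union>i. {..<real i}) = UNIV"
      by blast
    fix i
    \<comment> \<open>The formula \<open>*\<close> requires a positive radius and \<open>i\<close>
      may be 0, hence the detour through \<open>Suc i\<close>.\<close>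
    have "emeasure M {..<real i} \<le> emeasure M {..<real (Suc i)}"
      by (rule emeasure_mono) (auto simp: M_def)
    also have "\<dots> < \<infinity>"
      unfolding *[of "real (Suc i)", OF of_nat_0_less_iff[THEN iffD2, OF zero_less_Suc]]
      using fin v_fin by (simp add: ennreal_mult_less_top del: emeasure_lborel_ball_finite)
    finally show "emeasure M {..<real i} \<noteq> \<infinity>" by simp
  next
    show "sets M = sigma_sets UNIV (range lessThan)" "sets N = sigma_sets UNIV (range lessThan)"
      by (simp_all add: M_def N_def borel_Iio)
  qed auto
  have "?v * (\<integral>\<^sup>+x. \<phi> (norm x) * H x \<partial>lborel) = (\<integral>\<^sup>+x. ?v * H x * \<phi> (norm x) \<partial>lborel)"
    by (subst nn_integral_cmult[symmetric]) (simp_all add: mult_ac)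
  also have "\<dots> = (\<integral>\<^sup>+r. \<phi> r \<partial>M)"
    unfolding M_def by (subst nn_integral_distr) (simp_all add: nn_integral_density)
  also have "\<dots> = (\<integral>\<^sup>+x. ?C * \<phi> (norm (x::'a)) \<partial>lborel)"
    unfolding \<open>M = N\<close> N_def by (subst nn_integral_distr) (simp_all add: nn_integral_density)
  also have "\<dots> = ?C * (\<integral>\<^sup>+x. \<phi> (norm (x::'a)) \<partial>lborel)"
    by (rule nn_integral_cmult) simp
  finally show ?thesis .
qed

section \<open>The standard Gaussian measure: total mass, characteristic function, moments\<close>

definition gauss :: "'a::euclidean_space measure" where
  "gauss = density lborel (\<lambda>x. ennreal (\<Prod>b\<in>Basis. std_normal_density (x \<bullet> b)))"

lemma sets_gauss [measurable_cong, simp]: "sets gauss = sets borel"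
  by (simp add: gauss_def)

lemma space_gauss [simp]: "space gauss = UNIV"
  by (simp add: gauss_def)

text \<open>The defining product suits coordinatewise integration; this radial form of the density
  is what allows norm and direction to be separated.\<close>

lemma gauss_density_norm:
  "(\<Prod>b\<in>Basis. std_normal_density (x \<bullet> b)) =
    (1 / sqrt (2 * pi)) ^ DIM('a) * exp (- (norm x)\<^sup>2 / 2)" for x :: "'a::euclidean_space"
proof -
  have "(norm x)\<^sup>2 = (\<Sum>b\<in>Basis. (x \<bullet> b)\<^sup>2)"
    by (subst euclidean_inner[of x x, folded power2_norm_eq_inner]) (simp add: power2_eq_square)
  then have "exp (- (norm x)\<^sup>2 / 2) = (\<Prod>b\<in>Basis. exp (- (x \<bullet> b)\<^sup>2 / 2))"
    by (simp add: sum_divide_distrib sum_negf flip: exp_sum)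
  then show ?thesis
    by (simp add: std_normal_density_def prod.distrib prod_dividef power_divide)
qed

lemma prob_space_gauss: "prob_space (gauss :: 'a::euclidean_space measure)"
proof
  have "emeasure (gauss :: 'a measure) (space gauss)
      = (\<integral>\<^sup>+x. (\<Prod>b\<in>Basis. ennreal (std_normal_density ((x::'a) \<bullet> b))) \<partial>lborel)"
    by (simp add: gauss_def emeasure_density prod_ennreal)
  also have "\<dots> = (\<Prod>b\<in>(Basis::'a set). (\<integral>\<^sup>+x. ennreal (std_normal_density x) \<partial>lborel))"
    by (rule nn_integral_lborel_prod) auto
  also have "(\<integral>\<^sup>+x. ennreal (std_normal_density x) \<partial>lborel) = 1"
    using prob_space.emeasure_space_1[OF prob_space_normal_density[of 1 0]]
    by (simp add: emeasure_density)
  finally show "emeasure (gauss :: 'a measure) (space gauss) = 1"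
    by simp
qed

lemma sigma_finite_gauss: "sigma_finite_measure (gauss :: 'a::euclidean_space measure)"
  using prob_space_gauss prob_space_imp_sigma_finite by blast

text \<open>The density and the exponential both factor over the coordinates, so the integral is a
  product of one-dimensional normal characteristic functions.\<close>

lemma integral_gauss_iexp:
  fixes p :: "'a::euclidean_space"
  shows "(CLINT x|gauss. iexp (p \<bullet> x)) = of_real (exp (- (norm p)\<^sup>2 / 2))"
proof -
  interpret product_sigma_finite "\<lambda>_::'a. lborel :: real measure"
    by standard
  have int: "integrable lborel (\<lambda>t. of_real (std_normal_density t) * iexp (s * t))" for s
  proof -
    interpret N: prob_space std_normal_distribution
      by (rule prob_space_normal_density) simp
    have "integrable std_normal_distribution (\<lambda>t. iexp (s * t))"
      by (rule N.integrable_const_bound[where B = 1]) auto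
    then show ?thesis
      by (subst (asm) integrable_density) (auto simp: scaleR_conv_of_real)
  qed
  have ch: "(CLINT t|lborel. of_real (std_normal_density t) * iexp (s * t)) = of_real (exp (- s\<^sup>2 / 2))" for s
    using fun_cong[OF char_std_normal_distribution, of s] unfolding char_def
    by (subst (asm) integral_density) (auto simp: scaleR_conv_of_real)
  have split: "iexp (p \<bullet> x) = (\<Prod>b\<in>Basis. iexp ((p \<bullet> b) * (x \<bullet> b)))" for x
    by (subst euclidean_inner) (simp add: sum_distrib_left flip: exp_sum)
  have "(CLINT x|gauss. iexp (p \<bullet> x))
      = (CLINT x|lborel. of_real (\<Prod>b\<in>Basis. std_normal_density (x \<bullet> b)) * iexp (p \<bullet> x))"
    unfolding gauss_def by (subst integral_density) (auto simp: prod_nonneg scaleR_conv_of_real)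
  also have "\<dots> = (CLINT x|lborel. (\<Prod>b\<in>Basis. of_real (std_normal_density (x \<bullet> b)) * iexp ((p \<bullet> b) * (x \<bullet> b))))"
    by (simp add: split prod.distrib)
  also have "\<dots> = (CLINT f|Pi\<^sub>M Basis (\<lambda>_::'a. lborel).
      (\<Prod>b\<in>Basis. of_real (std_normal_density (f b)) * iexp ((p \<bullet> b) * f b)))"
    by (subst lborel_eq, subst integral_distr) simp_all
  also have "\<dots> = (\<Prod>b\<in>Basis. CLINT t|lborel. of_real (std_normal_density t) * iexp ((p \<bullet> b) * t))"
    by (rule product_integral_prod) (use int in simp_all)
  also have "\<dots> = of_real (exp (- (norm p)\<^sup>2 / 2))"
    unfolding ch
    by (subst power2_norm_eq_inner, subst euclidean_inner)
       (simp add: power2_eq_square sum_negf sum_divide_distrib flip: exp_sum of_real_prod)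
  finally show ?thesis .
qed

lemma integral_gauss_cos:
  fixes p :: "'a::euclidean_space"
  shows "(LINT x|gauss. cos (p \<bullet> x)) = exp (- (norm p)\<^sup>2 / 2)"
proof -
  interpret G: prob_space "gauss :: 'a measure"
    by (rule prob_space_gauss)
  have "integrable gauss (\<lambda>x. iexp (p \<bullet> x))"
    by (rule G.integrable_const_bound[where B = 1]) auto
  then have "(LINT x|gauss. Re (iexp (p \<bullet> x))) = Re (CLINT x|gauss. iexp (p \<bullet> x))"
    by (rule integral_Re)
  then show ?thesis
    by (simp add: integral_gauss_iexp Re_exp)
qed

text \<open>Half of the Gaussian decay absorbs the power of the norm; the other half is integrable.
  Applied with \<open>k\<close> equal to 2 and 3, this gives the finiteness that permits cancelling
  moments later.\<close>

lemma nn_integral_norm_power_gauss_finite: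
  assumes "k \<le> 4"
  shows "(\<integral>\<^sup>+x. ennreal (norm (x::'a::euclidean_space) ^ k) \<partial>gauss) < \<infinity>"
proof -
  define c where "c = (1 / sqrt (2 * pi)) ^ DIM('a)"
  have bound: "r ^ k * exp (- r\<^sup>2 / 2) \<le> 33 * exp (- r\<^sup>2 / 4)" if r: "r \<ge> 0" for r :: real
  proof -
    \<comment> \<open>With x = r^2/4, the power r^4 is 32 times the Taylor term x^2/2 of exp x, and
      1 is at most exp x; together they give the constant 33.\<close>
    have "r ^ k \<le> 1 + r ^ 4"
    proof (cases "r \<le> 1")
      case True
      then show ?thesis using power_le_one[OF r True, of k] zero_le_power[OF r, of 4] by linarith
    next
      case False
      then show ?thesis using power_increasing[OF assms, of r] by linarith
    qed
    also have "\<dots> \<le> 33 * exp (r\<^sup>2 / 4)"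
    proof -
      have "1 + r\<^sup>2 / 4 + (r\<^sup>2 / 4)\<^sup>2 / 2 \<le> exp (r\<^sup>2 / 4)"
        by (rule exp_lower_Taylor_quadratic) simp
      moreover have "(r\<^sup>2 / 4)\<^sup>2 / 2 = r ^ 4 / 32"
        by (simp add: power_divide flip: power_mult)
      moreover have "0 \<le> r\<^sup>2" "0 \<le> r ^ 4" by (use r in simp_all)
      ultimately show ?thesis by linarith
    qed
    finally have "r ^ k * exp (- r\<^sup>2 / 2) \<le> 33 * exp (r\<^sup>2 / 4) * exp (- r\<^sup>2 / 2)"
      by (rule mult_right_mono) simp
    also have "\<dots> = 33 * exp (- r\<^sup>2 / 4)"
      by (simp add: mult.assoc flip: exp_add)
    finally show ?thesis .
  qed
  \<comment> \<open>The remaining decay is that of a normal law of variance 2 in each coordinate,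
    and 2 sqrt pi is its normalising constant.\<close>
  have exp_norm: "exp (- (norm x)\<^sup>2 / 4) = (\<Prod>b\<in>Basis. 2 * sqrt pi * normal_density 0 (sqrt 2) (x \<bullet> b))"
    for x :: 'a
  proof -
    have "2 * sqrt pi * normal_density 0 (sqrt 2) t = exp (- t\<^sup>2 / 4)" for t
      by (simp add: normal_density_def real_sqrt_mult)
    moreover have "(norm x)\<^sup>2 = (\<Sum>b\<in>Basis. (x \<bullet> b)\<^sup>2)"
      by (subst euclidean_inner[of x x, folded power2_norm_eq_inner]) (simp add: power2_eq_square)
    ultimately show ?thesis
      by (simp add: sum_divide_distrib sum_negf flip: exp_sum)
  qed
  have "(\<integral>\<^sup>+x. ennreal (norm (x::'a) ^ k) \<partial>gauss)
      = (\<integral>\<^sup>+x. ennreal (c * (norm x ^ k * exp (- (norm x)\<^sup>2 / 2))) \<partial>(lborel :: 'a measure))"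
    unfolding gauss_def by (subst nn_integral_density)
      (simp_all add: gauss_density_norm mult_ac c_def flip: ennreal_mult')
  also have "\<dots> \<le> (\<integral>\<^sup>+x. ennreal (c * (33 * exp (- (norm x)\<^sup>2 / 4))) \<partial>(lborel :: 'a measure))"
    by (intro nn_integral_mono ennreal_leI mult_left_mono bound) (auto simp: c_def)
  also have "\<dots> = ennreal (c * 33) * (\<integral>\<^sup>+x. ennreal (exp (- (norm x)\<^sup>2 / 4)) \<partial>(lborel :: 'a measure))"
    by (subst nn_integral_cmult[symmetric]) (auto simp: c_def mult.assoc simp flip: ennreal_mult')
  also have "(\<integral>\<^sup>+x. ennreal (exp (- (norm x)\<^sup>2 / 4)) \<partial>(lborel :: 'a measure))
      = (\<integral>\<^sup>+x. (\<Prod>b\<in>Basis. ennreal (2 * sqrt pi * normal_density 0 (sqrt 2) (x \<bullet> b))) \<partial>(lborel :: 'a measure))"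
    by (simp only: exp_norm) (simp add: prod_ennreal)
  also have "\<dots> = (\<Prod>b\<in>(Basis::'a set). (\<integral>\<^sup>+t. ennreal (2 * sqrt pi * normal_density 0 (sqrt 2) t) \<partial>lborel))"
    by (rule nn_integral_lborel_prod) auto
  also have "(\<integral>\<^sup>+t. ennreal (2 * sqrt pi * normal_density 0 (sqrt 2) t) \<partial>lborel)
      = ennreal (2 * sqrt pi) * (\<integral>\<^sup>+t. ennreal (normal_density 0 (sqrt 2) t) \<partial>lborel)"
    by (subst nn_integral_cmult[symmetric]) (auto simp flip: ennreal_mult')
  also have "(\<integral>\<^sup>+t. ennreal (normal_density 0 (sqrt 2) t) \<partial>lborel) = 1"
    using prob_space.emeasure_space_1[OF prob_space_normal_density[of "sqrt 2" 0]]
    by (simp add: emeasure_density)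
  finally show ?thesis
    by (rule le_less_trans) (simp add: ennreal_mult_less_top ennreal_power)
qed

section \<open>Moments on the sphere as Gaussian moments\<close>

lemma borel_measurable_prod_list_inner [measurable]:
  fixes ns :: "'a::euclidean_space list"
  shows "(\<lambda>x. \<Prod>n\<leftarrow>ns. \<bar>x \<bullet> n\<bar>) \<in> borel_measurable borel"
  by (induction ns) simp_all

lemma prod_list_abs_inner_le:
  assumes "norm x \<le> 1"
  shows "(\<Prod>n\<leftarrow>ns. \<bar>x \<bullet> n\<bar>) \<le> (\<Prod>n\<leftarrow>ns. norm n)"
proof (induction ns)
  case (Cons n ns)
  have "\<bar>x \<bullet> n\<bar> \<le> norm x * norm n"
    by (rule Cauchy_Schwarz_ineq2)
  also have "\<dots> \<le> norm n"
    using assms by (simp add: mult_left_le_one_le)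
  finally show ?case
    using Cons by (auto intro!: mult_mono prod_list_nonneg)
qed simp

text \<open>The moment is defined as a Bochner integral, whereas the argument runs with nonnegative
  integrals. The integrand is bounded on the sphere, which carries the measure, so the two
  agree.\<close>

lemma nn_integral_uniform_S2_prod:
  "(\<integral>\<^sup>+u. ennreal (\<Prod>n\<leftarrow>ns. \<bar>u \<bullet> n\<bar>) \<partial>uniform_S2) = ennreal (abs_moment ns)"
proof -
  interpret prob_space uniform_S2
    by (rule prob_space_uniform_S2)
  have [measurable_cong]: "sets uniform_S2 = sets borel"
    by (simp add: uniform_S2_def)
  have nonneg: "(\<Prod>n\<leftarrow>ns. \<bar>u \<bullet> n\<bar>) \<ge> 0" for u :: "real^3"
    by (rule prod_list_nonneg) auto
  have "integrable uniform_S2 (\<lambda>u. \<Prod>n\<leftarrow>ns. \<bar>u \<bullet> n\<bar>)"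
  proof (rule integrable_const_bound)
    show "AE u in uniform_S2. norm (\<Prod>n\<leftarrow>ns. \<bar>u \<bullet> n\<bar>) \<le> (\<Prod>n\<leftarrow>ns. norm n)"
      using AE_uniform_S2 by eventually_elim (simp add: prod_list_abs_inner_le nonneg)
  qed simp
  then show ?thesis
    unfolding abs_moment_def by (rule nn_integral_eq_integral) (simp add: nonneg)
qed

text \<open>The product is a power of the norm times a function \<open>H\<close> of the direction
  alone, and the average of \<open>H\<close> over the ball is the moment on the sphere. The second
  factor depends only on the number of directions, so equal moments give equal Gaussian
  moments.\<close>

lemma nn_integral_gauss_prod:
  "(\<integral>\<^sup>+x. ennreal (\<Prod>n\<leftarrow>ns. \<bar>x \<bullet> n\<bar>) \<partial>gauss)
    = ennreal (abs_moment ns) * (\<integral>\<^sup>+x. ennreal (norm (x::real^3) ^ length ns) \<partial>gauss)"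
proof -
  define H :: "real^3 \<Rightarrow> ennreal" where "H x = ennreal (\<Prod>n\<leftarrow>ns. \<bar>(x /\<^sub>R norm x) \<bullet> n\<bar>)" for x
  define d where "d r = ennreal ((1 / sqrt (2 * pi)) ^ DIM(real^3) * exp (- r\<^sup>2 / 2))" for r :: real
  define \<phi> where "\<phi> r = d r * ennreal (r ^ length ns)" for r :: real
  let ?v = "emeasure lborel (ball (0::real^3) 1)"
  have v: "?v \<noteq> 0" "?v \<noteq> \<infinity>" "?v < \<infinity>"
    using emeasure_unit_ball by (auto simp: less_top)
  have [measurable]: "H \<in> borel_measurable borel"
    unfolding H_def
    by (intro measurable_compose[OF _ measurable_ennreal] measurable_compose[OF _ borel_measurable_prod_list_inner])
       measurable
  have [measurable]: "\<phi> \<in> borel_measurable borel" "d \<in> borel_measurable borel"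
    by (simp_all add: \<phi>_def[abs_def] d_def[abs_def])
  have gauss: "(gauss :: (real^3) measure) = density lborel (\<lambda>x. d (norm x))"
    by (simp add: gauss_def gauss_density_norm d_def)
  have split: "ennreal (\<Prod>n\<leftarrow>ns. \<bar>x \<bullet> n\<bar>) = ennreal (norm x ^ length ns) * H x" for x :: "real^3"
  proof -
    have "\<bar>x \<bullet> n\<bar> = norm x * \<bar>(x /\<^sub>R norm x) \<bullet> n\<bar>" for n
      by (cases "x = 0") (simp_all add: abs_mult)
    then have "(\<Prod>n\<leftarrow>ns. \<bar>x \<bullet> n\<bar>) = norm x ^ length ns * (\<Prod>n\<leftarrow>ns. \<bar>(x /\<^sub>R norm x) \<bullet> n\<bar>)"
      by (induction ns) simp_all
    then show ?thesis
      by (simp add: H_def ennreal_mult')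
  qed
  have "ennreal (abs_moment ns) = (\<integral>\<^sup>+x. H x \<partial>uniform_measure lborel (ball 0 1))"
    unfolding H_def by (simp add: nn_integral_uniform_S2_prod[symmetric] uniform_S2_def nn_integral_distr)
  also have "\<dots> = (\<integral>\<^sup>+x. H x * indicator (ball 0 1) x \<partial>lborel) / ?v"
    by (rule nn_integral_uniform_measure) auto
  finally have C: "(\<integral>\<^sup>+x. H x * indicator (ball 0 1) x \<partial>lborel) = ?v * ennreal (abs_moment ns)"
    using v by (simp add: ennreal_times_divide ennreal_mult_divide_eq mult.commute[of ?v])
  have "?v * (\<integral>\<^sup>+x. ennreal (\<Prod>n\<leftarrow>ns. \<bar>x \<bullet> n\<bar>) \<partial>gauss) = ?v * (\<integral>\<^sup>+x. \<phi> (norm x) * H x \<partial>lborel)"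
    by (simp add: gauss nn_integral_density split \<phi>_def mult.assoc)
  also have "\<dots> = (?v * ennreal (abs_moment ns)) * (\<integral>\<^sup>+x. \<phi> (norm (x::real^3)) \<partial>lborel)"
    unfolding C[symmetric]
  proof (rule nn_integral_radial_mult)
    show "(\<integral>\<^sup>+x. H x * indicator (ball 0 1) x \<partial>lborel) < \<infinity>"
      using v by (simp only: C) (simp add: ennreal_mult_less_top)
    show "H (c *\<^sub>R x) = H x" if "c > 0" for c x
    proof -
      have "(c *\<^sub>R x) /\<^sub>R norm (c *\<^sub>R x) = x /\<^sub>R norm x"
        using that by simp
      then show ?thesis by (simp only: H_def)
    qed
  qed simp_all
  also have "\<dots> = ?v * (ennreal (abs_moment ns) * (\<integral>\<^sup>+x. ennreal (norm (x::real^3) ^ length ns) \<partial>gauss))"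
    by (simp add: gauss nn_integral_density \<phi>_def mult.assoc)
  finally show ?thesis
    using v by (simp add: ennreal_mult_cancel_left)
qed

section \<open>The kernel representation of the absolute value\<close>

text \<open>At \<open>a = 0\<close> division by zero makes the value 0 instead of the limit t^2/2; a
  single point does not affect the integral over \<open>a\<close>.\<close>

definition abs_kernel :: "real \<Rightarrow> real \<Rightarrow> real" where
  "abs_kernel a t = (1 - cos (a * t)) / a\<^sup>2"

text \<open>The constant \<kappa> of the introductory text, whose classical value is pi.\<close>

definition abs_kernel_mass :: ennreal where
  "abs_kernel_mass = (\<integral>\<^sup>+a. ennreal (abs_kernel a 1) \<partial>lborel)"

lemma abs_kernel_nonneg [simp]: "abs_kernel a t \<ge> 0"
  by (simp add: abs_kernel_def)

lemma borel_measurable_abs_kernel [measurable (raw)]: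
  assumes [measurable]: "f \<in> borel_measurable M" "g \<in> borel_measurable M"
  shows "(\<lambda>x. abs_kernel (f x) (g x)) \<in> borel_measurable M"
  unfolding abs_kernel_def by measurable

text \<open>Substituting a = s/t multiplies the kernel by t^2, and the Jacobian contributes
  1/|t|.\<close>

lemma nn_integral_abs_kernel:
  "(\<integral>\<^sup>+a. ennreal (abs_kernel a t) \<partial>lborel) = ennreal \<bar>t\<bar> * abs_kernel_mass"
proof (cases "t = 0")
  case True
  then show ?thesis by (simp add: abs_kernel_def)
next
  case False
  have "abs_kernel (1 / t * s) t = t\<^sup>2 * abs_kernel s 1" for s
    using False by (simp add: abs_kernel_def power_divide)
  then have "(\<integral>\<^sup>+a. ennreal (abs_kernel a t) \<partial>lborel)
      = ennreal \<bar>1 / t\<bar> * (\<integral>\<^sup>+s. ennreal (t\<^sup>2) * ennreal (abs_kernel s 1) \<partial>lborel)"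
    using False by (subst nn_integral_real_affine[where c = "1 / t" and t = 0]) (simp_all add: ennreal_mult')
  also have "\<dots> = ennreal (\<bar>1 / t\<bar> * t\<^sup>2) * abs_kernel_mass"
    by (subst nn_integral_cmult) (simp_all add: abs_kernel_mass_def ennreal_mult mult.assoc del: abs_divide times_divide_eq_left)
  also have "\<bar>1 / t\<bar> * t\<^sup>2 = \<bar>t\<bar>"
    using False by (simp add: power2_eq_square abs_if)
  finally show ?thesis .
qed

text \<open>The bounds a^2/2 (sharp near 0) and 2 (for large \<open>a\<close>) on 1 - cos a add up
  to a single multiple of the Cauchy density.\<close>

lemma abs_kernel_mass_finite: "abs_kernel_mass < \<infinity>"
proof -
  have bound: "abs_kernel a 1 \<le> 5/2 * inverse (1 + a\<^sup>2)" for a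
  proof (cases "a = 0")
    case False
    have "(sin (a / 2))\<^sup>2 \<le> (a / 2)\<^sup>2"
      using abs_sin_x_le_abs_x[of "a / 2"] by (simp only: abs_le_square_iff)
    then have "1 - cos a \<le> a\<^sup>2 / 2"
      using cos_double_sin[of "a / 2"] by (simp add: power_divide)
    moreover have "(1 - cos a) * a\<^sup>2 \<le> 2 * a\<^sup>2"
      using cos_ge_minus_one[of a] by (intro mult_right_mono) auto
    ultimately have "(1 - cos a) * (1 + a\<^sup>2) \<le> 5/2 * a\<^sup>2"
      by (simp add: algebra_simps)
    then show ?thesis
      using False by (simp add: abs_kernel_def divide_simps add_pos_nonneg) (simp add: algebra_simps)
  qed (simp add: abs_kernel_def)
  have "integrable lborel (\<lambda>a. 5/2 * inverse (1 + a\<^sup>2) :: real)"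
    using integrable_inverse_1_plus_square by (simp add: set_integrable_def)
  then have "(\<integral>\<^sup>+a. ennreal (5/2 * inverse (1 + a\<^sup>2)) \<partial>lborel) < \<infinity>"
    by (subst nn_integral_eq_integral) (auto intro!: add_nonneg_nonneg)
  moreover have "abs_kernel_mass \<le> (\<integral>\<^sup>+a. ennreal (5/2 * inverse (1 + a\<^sup>2)) \<partial>lborel)"
    unfolding abs_kernel_mass_def by (intro nn_integral_mono ennreal_leI bound)
  ultimately show ?thesis
    by (rule le_less_trans[rotated])
qed

text \<open>Tonelli for one factor. The function \<open>h\<close> holds the factors not treated at
  this stage, so that the step can be iterated for pairs and triples.\<close>

lemma nn_integral_gauss_abs_inner:
  fixes u :: "'a::euclidean_space"
  assumes [measurable]: "h \<in> borel_measurable borel"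
  shows "(\<integral>\<^sup>+x. h x * ennreal \<bar>x \<bullet> u\<bar> \<partial>gauss) * abs_kernel_mass
    = (\<integral>\<^sup>+a. (\<integral>\<^sup>+x. h x * ennreal (abs_kernel a (x \<bullet> u)) \<partial>gauss) \<partial>lborel)"
proof -
  interpret G: sigma_finite_measure "gauss :: 'a measure"
    by (rule sigma_finite_gauss)
  interpret pair_sigma_finite "gauss :: 'a measure" "lborel :: real measure" ..
  have "(\<integral>\<^sup>+x. h x * ennreal \<bar>x \<bullet> u\<bar> \<partial>gauss) * abs_kernel_mass
      = (\<integral>\<^sup>+x. h x * (\<integral>\<^sup>+a. ennreal (abs_kernel a (x \<bullet> u)) \<partial>lborel) \<partial>gauss)"
    by (subst nn_integral_multc[symmetric]) (simp_all add: nn_integral_abs_kernel mult.assoc)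
  also have "\<dots> = (\<integral>\<^sup>+x. (\<integral>\<^sup>+a. h x * ennreal (abs_kernel a (x \<bullet> u)) \<partial>lborel) \<partial>gauss)"
    by (simp add: nn_integral_cmult)
  also have "\<dots> = (\<integral>\<^sup>+a. (\<integral>\<^sup>+x. h x * ennreal (abs_kernel a (x \<bullet> u)) \<partial>gauss) \<partial>lborel)"
    by (rule Fubini'[symmetric]) simp
  finally show ?thesis .
qed

lemma nn_integral_gauss_abs_inner2:
  fixes u v :: "'a::euclidean_space"
  assumes [measurable]: "h \<in> borel_measurable borel"
  shows "(\<integral>\<^sup>+x. h x * ennreal \<bar>x \<bullet> u\<bar> * ennreal \<bar>x \<bullet> v\<bar> \<partial>gauss) * abs_kernel_mass ^ 2
    = (\<integral>\<^sup>+a. \<integral>\<^sup>+b. \<integral>\<^sup>+x. h x * ennreal (abs_kernel a (x \<bullet> u)) * ennreal (abs_kernel b (x \<bullet> v))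
        \<partial>gauss \<partial>lborel \<partial>lborel)"
proof -
  interpret G: sigma_finite_measure "gauss :: 'a measure"
    by (rule sigma_finite_gauss)
  have "(\<integral>\<^sup>+x. h x * ennreal \<bar>x \<bullet> u\<bar> * ennreal \<bar>x \<bullet> v\<bar> \<partial>gauss) * abs_kernel_mass ^ 2
      = (\<integral>\<^sup>+x. (h x * ennreal \<bar>x \<bullet> v\<bar>) * ennreal \<bar>x \<bullet> u\<bar> \<partial>gauss) * abs_kernel_mass * abs_kernel_mass"
    by (simp add: mult_ac power2_eq_square)
  also have "\<dots> = (\<integral>\<^sup>+a. \<integral>\<^sup>+x. (h x * ennreal \<bar>x \<bullet> v\<bar>) * ennreal (abs_kernel a (x \<bullet> u)) \<partial>gauss \<partial>lborel)
      * abs_kernel_mass"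
    by (subst nn_integral_gauss_abs_inner) simp_all
  also have "\<dots> = (\<integral>\<^sup>+a. (\<integral>\<^sup>+x. (h x * ennreal (abs_kernel a (x \<bullet> u))) * ennreal \<bar>x \<bullet> v\<bar> \<partial>gauss)
      * abs_kernel_mass \<partial>lborel)"
    by (subst nn_integral_multc[symmetric]) (simp_all add: mult_ac)
  also have "\<dots> = (\<integral>\<^sup>+a. \<integral>\<^sup>+b. \<integral>\<^sup>+x. (h x * ennreal (abs_kernel a (x \<bullet> u))) * ennreal (abs_kernel b (x \<bullet> v))
      \<partial>gauss \<partial>lborel \<partial>lborel)"
    by (subst nn_integral_gauss_abs_inner) simp_all
  finally show ?thesis .
qed

lemma nn_integral_gauss_abs_inner3:
  fixes u v w :: "'a::euclidean_space"
  shows "(\<integral>\<^sup>+x. ennreal \<bar>x \<bullet> u\<bar> * ennreal \<bar>x \<bullet> v\<bar> * ennreal \<bar>x \<bullet> w\<bar> \<partial>gauss) * abs_kernel_mass ^ 3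
    = (\<integral>\<^sup>+a. \<integral>\<^sup>+b. \<integral>\<^sup>+c. \<integral>\<^sup>+x. ennreal (abs_kernel a (x \<bullet> u)) * ennreal (abs_kernel b (x \<bullet> v))
        * ennreal (abs_kernel c (x \<bullet> w)) \<partial>gauss \<partial>lborel \<partial>lborel \<partial>lborel)"
proof -
  interpret G: sigma_finite_measure "gauss :: 'a measure"
    by (rule sigma_finite_gauss)
  have "(\<integral>\<^sup>+x. ennreal \<bar>x \<bullet> u\<bar> * ennreal \<bar>x \<bullet> v\<bar> * ennreal \<bar>x \<bullet> w\<bar> \<partial>gauss) * abs_kernel_mass ^ 3
      = (\<integral>\<^sup>+x. (ennreal \<bar>x \<bullet> v\<bar> * ennreal \<bar>x \<bullet> w\<bar>) * ennreal \<bar>x \<bullet> u\<bar> \<partial>gauss) * abs_kernel_mass * abs_kernel_mass ^ 2"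
    by (simp add: mult_ac power2_eq_square power3_eq_cube)
  also have "\<dots> = (\<integral>\<^sup>+a. \<integral>\<^sup>+x. (ennreal \<bar>x \<bullet> v\<bar> * ennreal \<bar>x \<bullet> w\<bar>) * ennreal (abs_kernel a (x \<bullet> u)) \<partial>gauss \<partial>lborel)
      * abs_kernel_mass ^ 2"
    by (subst nn_integral_gauss_abs_inner) simp_all
  also have "\<dots> = (\<integral>\<^sup>+a. (\<integral>\<^sup>+x. ennreal (abs_kernel a (x \<bullet> u)) * ennreal \<bar>x \<bullet> v\<bar> * ennreal \<bar>x \<bullet> w\<bar> \<partial>gauss)
      * abs_kernel_mass ^ 2 \<partial>lborel)"
    by (subst nn_integral_multc[symmetric]) (simp_all add: mult_ac)
  also have "\<dots> = (\<integral>\<^sup>+a. \<integral>\<^sup>+b. \<integral>\<^sup>+c. \<integral>\<^sup>+x. ennreal (abs_kernel a (x \<bullet> u)) * ennreal (abs_kernel b (x \<bullet> v))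
        * ennreal (abs_kernel c (x \<bullet> w)) \<partial>gauss \<partial>lborel \<partial>lborel \<partial>lborel)"
    by (subst nn_integral_gauss_abs_inner2) simp_all
  finally show ?thesis .
qed

section \<open>Gaussian expectations of products of cosines and kernels\<close>

lemma integrable_gauss_cos [simp]: "integrable gauss (\<lambda>x::'a::euclidean_space. cos (p \<bullet> x))"
proof -
  interpret prob_space "gauss :: 'a measure"
    by (rule prob_space_gauss)
  show ?thesis
    by (rule integrable_const_bound[where B = 1]) simp_all
qed

lemma norm_sum3:
  fixes u v w :: "'a::real_inner"
  assumes "norm u = 1" "norm v = 1" "norm w = 1"
  shows "(norm (a *\<^sub>R u + b *\<^sub>R v + c *\<^sub>R w))\<^sup>2
    = a\<^sup>2 + b\<^sup>2 + c\<^sup>2 + 2 * (a * b * (u \<bullet> v) + a * c * (u \<bullet> w) + b * c * (v \<bullet> w))"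
proof -
  have "u \<bullet> u = 1" "v \<bullet> v = 1" "w \<bullet> w = 1"
    using assms by (simp_all add: norm_eq_1)
  then show ?thesis
    by (simp add: power2_norm_eq_inner inner_add_left inner_add_right inner_commute algebra_simps)
      (simp add: power2_eq_square)
qed

text \<open>Product-to-sum formulas leave four cosines of linear forms, whose expectations are
  Gaussian in the norm of the form. The squares of the coefficients give the common factor, and the
  mixed terms give exponentials in \<open>P\<close>, \<open>Q\<close>, \<open>R\<close>.\<close>

lemma has_bochner_integral_gauss_cos3:
  fixes u v w :: "'a::euclidean_space" and a b c :: real
  assumes unit: "norm u = 1" "norm v = 1" "norm w = 1"
  defines "P \<equiv> a * b * (u \<bullet> v)" and "Q \<equiv> a * c * (u \<bullet> w)" and "R \<equiv> b * c * (v \<bullet> w)"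
  shows "has_bochner_integral gauss (\<lambda>x. cos (a * (x \<bullet> u)) * cos (b * (x \<bullet> v)) * cos (c * (x \<bullet> w)))
      (exp (- (a\<^sup>2 + b\<^sup>2 + c\<^sup>2) / 2) * (cosh P * cosh Q * cosh R - sinh P * sinh Q * sinh R))"
proof -
  define D where "D = cosh P * cosh Q * cosh R - sinh P * sinh Q * sinh R"
  \<comment> \<open>Cosine is even, so only the signs of \<open>b\<close> and \<open>c\<close> vary,
    while \<open>a\<close> stays fixed.\<close>
  let ?e = "\<lambda>b c. a *\<^sub>R u + b *\<^sub>R v + c *\<^sub>R w"
  have trig: "cos \<alpha> * cos \<beta> * cos \<gamma>
      = (cos (\<alpha> + \<beta> + \<gamma>) + cos (\<alpha> + \<beta> + -\<gamma>) + cos (\<alpha> + -\<beta> + \<gamma>) + cos (\<alpha> + -\<beta> + -\<gamma>)) / 4"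
    for \<alpha> \<beta> \<gamma> :: real
    by (simp only: cos_add sin_add cos_minus sin_minus) (simp add: algebra_simps)
  have eq: "cos (a * (x \<bullet> u)) * cos (b * (x \<bullet> v)) * cos (c * (x \<bullet> w))
      = (cos (?e b c \<bullet> x) + cos (?e b (-c) \<bullet> x) + cos (?e (-b) c \<bullet> x) + cos (?e (-b) (-c) \<bullet> x)) / 4" for x
    by (subst trig) (simp only: inner_add_left inner_scaleR_left inner_commute[of x] mult_minus_left)
  have int: "integrable gauss (\<lambda>x. cos (a * (x \<bullet> u)) * cos (b * (x \<bullet> v)) * cos (c * (x \<bullet> w)))"
    unfolding eq by (intro integrable_divide_zero Bochner_Integration.integrable_add integrable_gauss_cos)
  have n: "exp (- (norm (?e b c))\<^sup>2 / 2) = exp (- (a\<^sup>2 + b\<^sup>2 + c\<^sup>2) / 2) *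
      exp (- (a * b * (u \<bullet> v) + a * c * (u \<bullet> w) + b * c * (v \<bullet> w)))" for b c
    unfolding norm_sum3[OF unit] exp_add[symmetric] by (simp add: field_simps)
  have "(LINT x|gauss. cos (a * (x \<bullet> u)) * cos (b * (x \<bullet> v)) * cos (c * (x \<bullet> w)))
      = (exp (- (norm (?e b c))\<^sup>2 / 2) + exp (- (norm (?e b (-c)))\<^sup>2 / 2)
        + exp (- (norm (?e (-b) c))\<^sup>2 / 2) + exp (- (norm (?e (-b) (-c)))\<^sup>2 / 2)) / 4"
    unfolding eq integral_gauss_cos[symmetric]
    by (subst Bochner_Integration.integral_divide_zero) (simp del: scaleR_minus_left minus_mult_minus add: Bochner_Integration.integral_add)
  also have "\<dots> = exp (- (a\<^sup>2 + b\<^sup>2 + c\<^sup>2) / 2) *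
      (exp (- (P + Q + R)) + exp (- (P - Q - R)) + exp (- (- P + Q - R)) + exp (- (- P - Q + R))) / 4"
    unfolding n P_def Q_def R_def by (simp add: algebra_simps)
  \<comment> \<open>In each of the four exponents the signs of \<open>P\<close>, \<open>Q\<close>,
    \<open>R\<close> multiply to -1. Writing exp as cosh + sinh, the terms with one or two sinh
    factors cancel, and the triple sinh term keeps a minus sign.\<close>
  also have "exp (- (P + Q + R)) + exp (- (P - Q - R)) + exp (- (- P + Q - R)) + exp (- (- P - Q + R))
      = 4 * D"
    by (simp add: D_def cosh_def sinh_def exp_add exp_diff exp_minus field_simps)
  finally show ?thesis
    using int by (simp add: has_bochner_integral_iff flip: D_def)
qed

lemma has_bochner_integral_gauss_cos2:
  fixes u v :: "'a::euclidean_space" and a b :: real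
  assumes unit: "norm u = 1" "norm v = 1"
  shows "has_bochner_integral gauss (\<lambda>x. cos (a * (x \<bullet> u)) * cos (b * (x \<bullet> v)))
      (exp (- a\<^sup>2 / 2) * exp (- b\<^sup>2 / 2) * cosh (a * b * (u \<bullet> v)))"
proof -
  have "exp (- a\<^sup>2 / 2) * exp (- b\<^sup>2 / 2) = exp (- (a\<^sup>2 + b\<^sup>2 + 0\<^sup>2) / 2)"
    by (simp add: add_divide_distrib diff_divide_distrib flip: exp_add)
  then show ?thesis
    \<comment> \<open>With third coefficient 0 the third cosine is 1, so \<open>v\<close> merely
      fills the place of the third direction.\<close>
    using has_bochner_integral_gauss_cos3[OF unit unit(2), of a b 0] by simp
qed

lemma has_bochner_integral_gauss_cos1:
  fixes u :: "'a::euclidean_space" and a :: real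
  assumes unit: "norm u = 1"
  shows "has_bochner_integral gauss (\<lambda>x. cos (a * (x \<bullet> u))) (exp (- a\<^sup>2 / 2))"
  using has_bochner_integral_gauss_cos2[OF unit unit, of a 0] by simp

lemma has_bochner_integral_gauss_one:
  "has_bochner_integral gauss (\<lambda>x::'a::euclidean_space. 1::real) 1"
proof -
  interpret prob_space "gauss :: 'a measure"
    by (rule prob_space_gauss)
  show ?thesis
    using prob_space by (simp add: has_bochner_integral_iff)
qed

lemma has_bochner_integral_nonneg:
  assumes "has_bochner_integral M f r" "\<And>x. f x \<ge> (0::real)"
  shows "r \<ge> 0"
  using assms by (auto simp: has_bochner_integral_iff)

lemma nn_integral_of_has_bochner_integral:
  assumes "has_bochner_integral M f r" "\<And>x. f x \<ge> 0"
  shows "(\<integral>\<^sup>+x. ennreal (f x) \<partial>M) = ennreal r"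
  using assms by (simp add: has_bochner_integral_iff nn_integral_eq_integral)

lemma has_bochner_integral_abs_kernel2:
  fixes u v :: "'a::euclidean_space"
  assumes unit: "norm u = 1" "norm v = 1"
  shows "has_bochner_integral gauss (\<lambda>x. abs_kernel a (x \<bullet> u) * abs_kernel b (x \<bullet> v))
    ((1 - exp (- a\<^sup>2 / 2) - exp (- b\<^sup>2 / 2) + exp (- a\<^sup>2 / 2) * exp (- b\<^sup>2 / 2) * cosh (a * b * (u \<bullet> v)))
      / (a\<^sup>2 * b\<^sup>2))"
proof -
  have eq: "abs_kernel a s * abs_kernel b t
      = (1 - cos (a * s) - cos (b * t) + cos (a * s) * cos (b * t)) / (a\<^sup>2 * b\<^sup>2)" for s t
    by (simp add: abs_kernel_def algebra_simps)
  show ?thesis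
    unfolding eq using unit
    by (intro has_bochner_integral_divide_zero has_bochner_integral_add has_bochner_integral_diff
        has_bochner_integral_gauss_one has_bochner_integral_gauss_cos1 has_bochner_integral_gauss_cos2)
qed

lemma has_bochner_integral_abs_kernel3:
  fixes u v w :: "'a::euclidean_space" and a b c :: real
  assumes unit: "norm u = 1" "norm v = 1" "norm w = 1"
  defines "g \<equiv> \<lambda>t. exp (- t\<^sup>2 / 2 :: real)"
    and "P \<equiv> a * b * (u \<bullet> v)" and "Q \<equiv> a * c * (u \<bullet> w)" and "R \<equiv> b * c * (v \<bullet> w)"
  shows "has_bochner_integral gauss
      (\<lambda>x. abs_kernel a (x \<bullet> u) * abs_kernel b (x \<bullet> v) * abs_kernel c (x \<bullet> w))
      ((1 - g a - g b - g c + g a * g b * cosh P + g a * g c * cosh Q + g b * g c * cosh R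
        - g a * g b * g c * (cosh P * cosh Q * cosh R - sinh P * sinh Q * sinh R)) / (a\<^sup>2 * b\<^sup>2 * c\<^sup>2))"
proof -
  have eq: "abs_kernel a s * abs_kernel b t * abs_kernel c r
      = (1 - cos (a * s) - cos (b * t) - cos (c * r) + cos (a * s) * cos (b * t) + cos (a * s) * cos (c * r)
        + cos (b * t) * cos (c * r) - cos (a * s) * cos (b * t) * cos (c * r)) / (a\<^sup>2 * b\<^sup>2 * c\<^sup>2)" for s t r
    \<comment> \<open>Numerators and denominators are compared separately, so no case distinction on
      zero parameters arises.\<close>
    unfolding abs_kernel_def times_divide_times_eq
    by (rule arg_cong2[where f = "(/)"]) (simp_all add: algebra_simps)
  have "g a * g b * g c = exp (- (a\<^sup>2 + b\<^sup>2 + c\<^sup>2) / 2)"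
    by (simp add: g_def add_divide_distrib diff_divide_distrib flip: exp_add)
  then show ?thesis
    unfolding eq g_def P_def Q_def R_def using unit
    by (simp only:) (intro has_bochner_integral_divide_zero has_bochner_integral_add has_bochner_integral_diff
        has_bochner_integral_gauss_one has_bochner_integral_gauss_cos1 has_bochner_integral_gauss_cos2
        has_bochner_integral_gauss_cos3)
qed

section \<open>Gram data determined by pair and triple moments\<close>

lemma borel_measurable_cosh [measurable (raw)]:
  assumes [measurable]: "f \<in> borel_measurable M"
  shows "(\<lambda>x. cosh (f x :: real)) \<in> borel_measurable M"
  unfolding cosh_def by measurable

lemma borel_measurable_sinh [measurable (raw)]:
  assumes [measurable]: "f \<in> borel_measurable M"
  shows "(\<lambda>x. sinh (f x :: real)) \<in> borel_measurable M"
  unfolding sinh_def by measurable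

text \<open>Applied once per variable, this carries positivity off the coordinate planes through an
  iterated integral. The origin is exempted because the integrands below are 0 there by division by
  zero.\<close>

lemma nn_integral_lborel_nonzero:
  fixes h :: "real \<Rightarrow> ennreal"
  assumes "h \<in> borel_measurable borel" and "\<And>a. a \<noteq> 0 \<Longrightarrow> h a \<noteq> 0"
  shows "(\<integral>\<^sup>+a. h a \<partial>lborel) \<noteq> 0"
proof
  assume "(\<integral>\<^sup>+a. h a \<partial>lborel) = 0"
  then have "AE a in lborel. h a = 0"
    using assms(1) by (simp add: nn_integral_0_iff_AE)
  moreover have "AE a in lborel. a \<noteq> (0::real)"
    by (rule AE_lborel_singleton)
  ultimately have "AE a in (lborel :: real measure). False"
    by eventually_elim (use assms(2) in blast)
  then show False
    by (simp add: eventually_False ae_filter_eq_bot_iff)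
qed

text \<open>If one absolute inner product were smaller, the pair integrands would differ by the
  strictly positive excess \<open>\<Delta>\<close> off the axes, by monotonicity of cosh. Equal
  moments force the integral of \<open>\<Delta>\<close> to be 0. The contradiction is stated for
  arbitrary vectors so that it excludes both strict inequalities.\<close>

lemma abs_inner_eq_of_abs_moment_eq:
  fixes u v u' v' :: "real^3"
  assumes unit: "norm u = 1" "norm v = 1" "norm u' = 1" "norm v' = 1"
    and eq: "abs_moment [u, v] = abs_moment [u', v']"
  shows "\<bar>u \<bullet> v\<bar> = \<bar>u' \<bullet> v'\<bar>"
proof -
  have False if unit: "norm u = 1" "norm v = 1" "norm u' = 1" "norm v' = 1"
    and eq: "abs_moment [u, v] = abs_moment [u', v']"
    and less: "\<bar>u \<bullet> v\<bar> < \<bar>u' \<bullet> v'\<bar>" for u v u' v' :: "real^3"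
  proof -
    define F where "F a b z = (1 - exp (- a\<^sup>2 / 2) - exp (- b\<^sup>2 / 2)
      + exp (- a\<^sup>2 / 2) * exp (- b\<^sup>2 / 2) * cosh (a * b * z)) / (a\<^sup>2 * b\<^sup>2)" for a b z :: real
    define \<Delta> where "\<Delta> a b = exp (- a\<^sup>2 / 2) * exp (- b\<^sup>2 / 2)
      * (cosh (a * b * (u' \<bullet> v')) - cosh (a * b * (u \<bullet> v))) / (a\<^sup>2 * b\<^sup>2)" for a b :: real
    define M where "M u v = (\<integral>\<^sup>+x. ennreal \<bar>x \<bullet> u\<bar> * ennreal \<bar>x \<bullet> v\<bar> \<partial>gauss)" for u v :: "real^3"
    have M: "M u v = ennreal (abs_moment [u, v]) * (\<integral>\<^sup>+x. ennreal (norm (x::real^3) ^ 2) \<partial>gauss)" for u v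
      using nn_integral_gauss_prod[of "[u, v]"] by (simp add: M_def ennreal_mult power2_eq_square)
    have ker: "(\<integral>\<^sup>+x. ennreal (abs_kernel a (x \<bullet> u)) * ennreal (abs_kernel b (x \<bullet> v)) \<partial>gauss)
        = ennreal (F a b (u \<bullet> v))" and F_nonneg: "F a b (u \<bullet> v) \<ge> 0"
      if "norm u = 1" "norm v = 1" for a b and u v :: "real^3"
      using nn_integral_of_has_bochner_integral[OF has_bochner_integral_abs_kernel2[OF that]]
        has_bochner_integral_nonneg[OF has_bochner_integral_abs_kernel2[OF that]]
      by (simp_all add: F_def ennreal_mult)
    have rep: "M u v * abs_kernel_mass ^ 2 = (\<integral>\<^sup>+a. \<integral>\<^sup>+b. ennreal (F a b (u \<bullet> v)) \<partial>lborel \<partial>lborel)"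
      if "norm u = 1" "norm v = 1" for u v
      using nn_integral_gauss_abs_inner2[of "\<lambda>_. 1" u v] by (simp add: M_def ker[OF that])
    have cosh_less: "cosh (t * (u \<bullet> v)) < cosh (t * (u' \<bullet> v'))" if "t \<noteq> 0" for t
    proof -
      have "cosh \<bar>t * (u \<bullet> v)\<bar> < cosh \<bar>t * (u' \<bullet> v')\<bar>"
        using that less by (subst cosh_real_nonneg_less_iff) (auto simp: abs_mult)
      then show ?thesis by simp
    qed
    then have pos: "\<Delta> a b > 0" if "a \<noteq> 0" "b \<noteq> 0" for a b
      using that by (simp add: \<Delta>_def)
    have nonzero: "ennreal (\<Delta> a b) \<noteq> 0" if "a \<noteq> 0" "b \<noteq> 0" for a b
      using pos[OF that] by simp
    \<comment> \<open>On the axes the excess is 0, since division by zero yields 0.\<close>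
    from pos have nonneg: "\<Delta> a b \<ge> 0" for a b
      by (cases "a = 0 \<or> b = 0") (auto simp: \<Delta>_def intro: less_imp_le)
    \<comment> \<open>Both summands are nonnegative, so the identity passes to extended nonnegative
      reals and the integrals can be added without subtraction.\<close>
    have F_split: "ennreal (F a b (u' \<bullet> v')) = ennreal (F a b (u \<bullet> v)) + ennreal (\<Delta> a b)" for a b
    proof -
      have "F a b (u' \<bullet> v') = F a b (u \<bullet> v) + \<Delta> a b"
        by (simp add: F_def \<Delta>_def algebra_simps flip: add_divide_distrib)
      then show ?thesis
        using F_nonneg[OF unit(1,2)] nonneg by simp
    qed
    have "M u v * abs_kernel_mass ^ 2 = M u' v' * abs_kernel_mass ^ 2"
      by (simp add: M eq)
    also have "\<dots> = M u v * abs_kernel_mass ^ 2 + (\<integral>\<^sup>+a. \<integral>\<^sup>+b. ennreal (\<Delta> a b) \<partial>lborel \<partial>lborel)"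
      unfolding rep[OF unit(3,4)] rep[OF unit(1,2)] F_split
      by (simp add: nn_integral_add F_def \<Delta>_def)
    finally have "M u v * abs_kernel_mass ^ 2 = M u v * abs_kernel_mass ^ 2
      + (\<integral>\<^sup>+a. \<integral>\<^sup>+b. ennreal (\<Delta> a b) \<partial>lborel \<partial>lborel)" .
    \<comment> \<open>Finiteness is what allows this term to be cancelled from both sides.\<close>
    moreover have "M u v * abs_kernel_mass ^ 2 < \<infinity>"
      using abs_kernel_mass_finite nn_integral_norm_power_gauss_finite[of 2, where 'a = "real^3"]
      by (simp add: M ennreal_mult_less_top power_less_top_ennreal)
    ultimately have "(\<integral>\<^sup>+a. \<integral>\<^sup>+b. ennreal (\<Delta> a b) \<partial>lborel \<partial>lborel) = 0"
      by (metis ennreal_add_left_cancel add.right_neutral infinity_ennreal_def less_irrefl)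
    moreover have "(\<integral>\<^sup>+a. \<integral>\<^sup>+b. ennreal (\<Delta> a b) \<partial>lborel \<partial>lborel) \<noteq> 0"
      by (intro nn_integral_lborel_nonzero nonzero) (simp_all add: \<Delta>_def)
    ultimately show False by contradiction
  qed
  from this[OF assms(1-5)] this[OF assms(3,4,1,2) eq[symmetric]] show ?thesis
    by (meson linorder_neqE_linordered_idom)
qed

lemma sinh_mult_pos3:
  fixes p q r :: real
  assumes "p * q * r > 0"
  shows "sinh p * sinh q * sinh r > 0"
proof -
  have "sgn (sinh t) = sgn t" for t :: real
    by (cases t "0::real" rule: linorder_cases) simp_all
  then have "sgn (sinh p * sinh q * sinh r) = sgn (p * q * r)"
    by (simp add: sgn_mult)
  then show ?thesis
    using assms by (metis sgn_1_pos)
qed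

text \<open>Equal absolute values make all cosh terms agree, so the triple integrands differ only in
  the product of three sinh factors. That product has the sign of the product of the three inner
  products, hence a strict difference of integrals.\<close>

lemma inner_prod_neg_abs_moment_neq:
  fixes u v w u' v' w' :: "real^3"
  assumes unit: "norm u = 1" "norm v = 1" "norm w = 1" and unit': "norm u' = 1" "norm v' = 1" "norm w' = 1"
    and abs: "\<bar>u \<bullet> v\<bar> = \<bar>u' \<bullet> v'\<bar>" "\<bar>u \<bullet> w\<bar> = \<bar>u' \<bullet> w'\<bar>" "\<bar>v \<bullet> w\<bar> = \<bar>v' \<bullet> w'\<bar>"
    and pos: "(u \<bullet> v) * (u \<bullet> w) * (v \<bullet> w) > 0" and neg: "(u' \<bullet> v') * (u' \<bullet> w') * (v' \<bullet> w') < 0"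
  shows "abs_moment [u, v, w] \<noteq> abs_moment [u', v', w']"
proof
  assume eq: "abs_moment [u, v, w] = abs_moment [u', v', w']"
  define g where "g t = exp (- t\<^sup>2 / 2)" for t :: real
  define S where "S a b c x y z = sinh (a * b * x) * sinh (a * c * y) * sinh (b * c * z)" for a b c x y z :: real
  define F where "F a b c x y z =
    (1 - g a - g b - g c + g a * g b * cosh (a * b * x) + g a * g c * cosh (a * c * y) + g b * g c * cosh (b * c * z)
      - g a * g b * g c * (cosh (a * b * x) * cosh (a * c * y) * cosh (b * c * z) - S a b c x y z))
      / (a\<^sup>2 * b\<^sup>2 * c\<^sup>2)" for a b c x y z :: real
  define \<Delta> where "\<Delta> a b c = g a * g b * g c * (S a b c (u \<bullet> v) (u \<bullet> w) (v \<bullet> w)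
    - S a b c (u' \<bullet> v') (u' \<bullet> w') (v' \<bullet> w')) / (a\<^sup>2 * b\<^sup>2 * c\<^sup>2)" for a b c :: real
  define M where "M u v w = (\<integral>\<^sup>+x. ennreal \<bar>x \<bullet> u\<bar> * ennreal \<bar>x \<bullet> v\<bar> * ennreal \<bar>x \<bullet> w\<bar> \<partial>gauss)"
    for u v w :: "real^3"
  have M: "M u v w = ennreal (abs_moment [u, v, w]) * (\<integral>\<^sup>+x. ennreal (norm (x::real^3) ^ 3) \<partial>gauss)" for u v w
    using nn_integral_gauss_prod[of "[u, v, w]"] by (simp add: M_def ennreal_mult power3_eq_cube mult.assoc)
  have ker: "(\<integral>\<^sup>+x. ennreal (abs_kernel a (x \<bullet> u)) * ennreal (abs_kernel b (x \<bullet> v)) * ennreal (abs_kernel c (x \<bullet> w)) \<partial>gauss)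
      = ennreal (F a b c (u \<bullet> v) (u \<bullet> w) (v \<bullet> w))" and F_nonneg: "F a b c (u \<bullet> v) (u \<bullet> w) (v \<bullet> w) \<ge> 0"
    if "norm u = 1" "norm v = 1" "norm w = 1" for a b c and u v w :: "real^3"
    using nn_integral_of_has_bochner_integral[OF has_bochner_integral_abs_kernel3[OF that]]
      has_bochner_integral_nonneg[OF has_bochner_integral_abs_kernel3[OF that]]
    by (simp_all add: F_def S_def g_def ennreal_mult)
  have rep: "M u v w * abs_kernel_mass ^ 3
      = (\<integral>\<^sup>+a. \<integral>\<^sup>+b. \<integral>\<^sup>+c. ennreal (F a b c (u \<bullet> v) (u \<bullet> w) (v \<bullet> w)) \<partial>lborel \<partial>lborel \<partial>lborel)"
    if "norm u = 1" "norm v = 1" "norm w = 1" for u v w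
    using nn_integral_gauss_abs_inner3[of u v w] by (simp add: M_def ker[OF that])
  have \<Delta>_pos: "\<Delta> a b c > 0" if nz: "a \<noteq> 0" "b \<noteq> 0" "c \<noteq> 0" for a b c
  proof -
    \<comment> \<open>Each parameter occurs in two of the three arguments. The product therefore
      acquires a square, and its sign does not depend on the signs of \<open>a\<close>,
      \<open>b\<close>, \<open>c\<close>.\<close>
    have *: "(a * b * x) * (a * c * y) * (b * c * z) = (a * b * c)\<^sup>2 * (x * y * z)" for x y z
      by (simp add: power2_eq_square)
    have "S a b c (u \<bullet> v) (u \<bullet> w) (v \<bullet> w) > 0"
      unfolding S_def by (rule sinh_mult_pos3) (use nz pos in \<open>simp only: *, simp add: zero_less_mult_iff\<close>)
    \<comment> \<open>Since sinh is odd, the minus sign moves into one argument, where it makes the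
      product of the arguments positive.\<close>
    moreover have "- S a b c (u' \<bullet> v') (u' \<bullet> w') (v' \<bullet> w') = S a b c (- (u' \<bullet> v')) (u' \<bullet> w') (v' \<bullet> w')"
      by (simp add: S_def)
    moreover have "S a b c (- (u' \<bullet> v')) (u' \<bullet> w') (v' \<bullet> w') > 0"
      unfolding S_def by (rule sinh_mult_pos3) (use nz neg in \<open>simp only: *, simp add: zero_less_mult_iff mult_less_0_iff\<close>)
    ultimately show ?thesis
      using nz by (simp add: \<Delta>_def g_def)
  qed
  have \<Delta>_nonzero: "ennreal (\<Delta> a b c) \<noteq> 0" if "a \<noteq> 0" "b \<noteq> 0" "c \<noteq> 0" for a b c
    using \<Delta>_pos[OF that] by simp
  from \<Delta>_pos have \<Delta>_nonneg: "\<Delta> a b c \<ge> 0" for a b c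
    by (cases "a = 0 \<or> b = 0 \<or> c = 0") (auto simp: \<Delta>_def intro: less_imp_le)
  have F_split: "ennreal (F a b c (u \<bullet> v) (u \<bullet> w) (v \<bullet> w))
      = ennreal (F a b c (u' \<bullet> v') (u' \<bullet> w') (v' \<bullet> w')) + ennreal (\<Delta> a b c)" for a b c
  proof -
    have cosh: "cosh (t * s) = cosh (t * s')" if "\<bar>s\<bar> = \<bar>s'\<bar>" for t s s' :: real
      using that by (metis abs_mult cosh_real_abs)
    have "F a b c (u \<bullet> v) (u \<bullet> w) (v \<bullet> w) = F a b c (u' \<bullet> v') (u' \<bullet> w') (v' \<bullet> w') + \<Delta> a b c"
      unfolding F_def \<Delta>_def cosh[OF abs(1)] cosh[OF abs(2)] cosh[OF abs(3)]
      by (simp add: algebra_simps flip: add_divide_distrib)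
    then show ?thesis
      using F_nonneg[OF unit'] \<Delta>_nonneg by simp
  qed
  have "M u' v' w' * abs_kernel_mass ^ 3 = M u v w * abs_kernel_mass ^ 3"
    by (simp add: M eq)
  also have "\<dots> = M u' v' w' * abs_kernel_mass ^ 3
      + (\<integral>\<^sup>+a. \<integral>\<^sup>+b. \<integral>\<^sup>+c. ennreal (\<Delta> a b c) \<partial>lborel \<partial>lborel \<partial>lborel)"
    unfolding rep[OF unit'] rep[OF unit] F_split
    by (simp add: nn_integral_add F_def S_def g_def \<Delta>_def)
  finally have "M u' v' w' * abs_kernel_mass ^ 3 = M u' v' w' * abs_kernel_mass ^ 3
    + (\<integral>\<^sup>+a. \<integral>\<^sup>+b. \<integral>\<^sup>+c. ennreal (\<Delta> a b c) \<partial>lborel \<partial>lborel \<partial>lborel)" .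
  moreover have "M u' v' w' * abs_kernel_mass ^ 3 < \<infinity>"
    using abs_kernel_mass_finite nn_integral_norm_power_gauss_finite[of 3, where 'a = "real^3"]
    by (simp add: M ennreal_mult_less_top power_less_top_ennreal)
  ultimately have "(\<integral>\<^sup>+a. \<integral>\<^sup>+b. \<integral>\<^sup>+c. ennreal (\<Delta> a b c) \<partial>lborel \<partial>lborel \<partial>lborel) = 0"
    by (metis ennreal_add_left_cancel add.right_neutral infinity_ennreal_def less_irrefl)
  moreover have "(\<integral>\<^sup>+a. \<integral>\<^sup>+b. \<integral>\<^sup>+c. ennreal (\<Delta> a b c) \<partial>lborel \<partial>lborel \<partial>lborel) \<noteq> 0"
    by (intro nn_integral_lborel_nonzero \<Delta>_nonzero) (simp_all add: \<Delta>_def S_def g_def)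
  ultimately show False by contradiction
qed

text \<open>The absolute values of the two products agree, so only opposite nonzero signs could
  separate them; the preceding lemma excludes these in both orders.\<close>

lemma inner_prod_eq_of_abs_moment_eq:
  fixes u v w u' v' w' :: "real^3"
  assumes unit: "norm u = 1" "norm v = 1" "norm w = 1" and unit': "norm u' = 1" "norm v' = 1" "norm w' = 1"
    and abs: "\<bar>u \<bullet> v\<bar> = \<bar>u' \<bullet> v'\<bar>" "\<bar>u \<bullet> w\<bar> = \<bar>u' \<bullet> w'\<bar>" "\<bar>v \<bullet> w\<bar> = \<bar>v' \<bullet> w'\<bar>"
    and eq: "abs_moment [u, v, w] = abs_moment [u', v', w']"
  shows "(u \<bullet> v) * (u \<bullet> w) * (v \<bullet> w) = (u' \<bullet> v') * (u' \<bullet> w') * (v' \<bullet> w')"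
proof -
  have "\<bar>(u \<bullet> v) * (u \<bullet> w) * (v \<bullet> w)\<bar> = \<bar>(u' \<bullet> v') * (u' \<bullet> w') * (v' \<bullet> w')\<bar>"
    by (simp add: abs_mult abs)
  then show ?thesis
    using inner_prod_neg_abs_moment_neq[OF unit unit' abs] eq
      inner_prod_neg_abs_moment_neq[OF unit' unit abs(1)[symmetric] abs(2)[symmetric] abs(3)[symmetric]]
    by (auto simp: abs_if split: if_splits)
qed

section \<open>Gram matrices and congruence\<close>

text \<open>For \<open>v = 0\<close> the formula is the identity, which covers the case of an image
  that is already correct.\<close>

lemma orthogonal_transformation_reflection:
  fixes v :: "'a::real_inner"
  shows "orthogonal_transformation (\<lambda>x. x - (2 * (x \<bullet> v) / (v \<bullet> v)) *\<^sub>R v)"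
  unfolding orthogonal_transformation_def
proof safe
  show "linear (\<lambda>x. x - (2 * (x \<bullet> v) / (v \<bullet> v)) *\<^sub>R v)"
    by (rule linearI) (simp_all add: algebra_simps inner_add_left add_divide_distrib)
qed (cases "v = 0", simp_all add: inner_diff_left inner_diff_right field_simps inner_commute)

text \<open>
  Extending an isometry by one more vector needs only a reflection: the one exchanging the current
  image and the prescribed image fixes all earlier images, since their inner products with both
  agree.
\<close>

lemma orthogonal_transformation_of_gram_eq:
  fixes f g :: "nat \<Rightarrow> 'a::euclidean_space"
  assumes "\<And>i j. i < m \<Longrightarrow> j < m \<Longrightarrow> f i \<bullet> f j = g i \<bullet> g j"
  shows "\<exists>T. orthogonal_transformation T \<and> (\<forall>i<m. T (f i) = g i)"
  using assms
proof (induction m)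
  case 0
  show ?case
    by (rule exI[of _ id]) (simp add: orthogonal_transformation_def linear_id)
next
  case (Suc m)
  then obtain T where T: "orthogonal_transformation T" and Tf: "\<And>i. i < m \<Longrightarrow> T (f i) = g i"
    by (metis less_SucI)
  define v where "v = T (f m) - g m"
  define R where "R = (\<lambda>x. x - (2 * (x \<bullet> v) / (v \<bullet> v)) *\<^sub>R v)"
  have R: "orthogonal_transformation R"
    unfolding R_def by (rule orthogonal_transformation_reflection)
  have inner_T: "T x \<bullet> T y = x \<bullet> y" for x y
    using T by (simp add: orthogonal_transformation_def)
  have fixed: "R (g i) = g i" if "i < m" for i
  proof -
    have "g i \<bullet> T (f m) = g i \<bullet> g m"
      using that Suc.prems[of i m] inner_T[of "f i" "f m"] Tf by simp
    then show ?thesis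
      by (simp add: R_def v_def inner_diff_right)
  qed
  have "T (f m) \<bullet> T (f m) = g m \<bullet> g m"
    using Suc.prems[of m m] inner_T by simp
  \<comment> \<open>Equality of lengths makes the reflection subtract exactly \<open>v\<close> from
    \<open>T (f m)\<close>.\<close>
  then have "2 * (T (f m) \<bullet> v) = v \<bullet> v"
    by (simp add: v_def inner_diff_left inner_diff_right inner_commute)
  then have "R (T (f m)) = g m"
    by (cases "v = 0") (simp_all add: R_def, simp_all add: v_def)
  then have "\<forall>i<Suc m. (R \<circ> T) (f i) = g i"
    using fixed Tf by (auto simp: less_Suc_eq)
  then show ?case
    using orthogonal_transformation_compose[OF R T] by blast
qed

text \<open>Orthogonal maps preserve inner products, which gives one direction. Conversely,
  correcting \<open>n'\<close> by the signs produces a family with the same Gram matrix as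
  \<open>n\<close>, and an isometry then matches the two families.\<close>

lemma same_config_iff_sign_conjugate:
  "same_config m n n' \<longleftrightarrow> sign_conjugate m (gram n) (gram n')"
proof
  assume "same_config m n n'"
  then obtain \<epsilon> and Q :: "real^3^3" where \<epsilon>: "sign_family m \<epsilon>" and Q: "orthogonal_matrix Q"
    and n': "\<And>i. i \<in> {1..m} \<Longrightarrow> n' i = \<epsilon> i *\<^sub>R (Q *v n i)"
    by (auto simp: same_config_def)
  have "(Q *v x) \<bullet> (Q *v y) = x \<bullet> y" for x y
    using Q orthogonal_transformation_matrix[of "(*v) Q"]
    by (simp add: orthogonal_transformation_def)
  with \<epsilon> n' show "sign_conjugate m (gram n) (gram n')"
    by (auto simp: sign_conjugate_def gram_def)
next
  assume "sign_conjugate m (gram n) (gram n')"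
  then obtain \<epsilon> where \<epsilon>: "sign_family m \<epsilon>"
    and G: "\<And>i j. i \<in> {1..m} \<Longrightarrow> j \<in> {1..m} \<Longrightarrow> n' i \<bullet> n' j = \<epsilon> i * (n i \<bullet> n j) * \<epsilon> j"
    by (auto simp: sign_conjugate_def gram_def)
  have sq: "\<epsilon> i * \<epsilon> i = 1" if "i \<in> {1..m}" for i
    using \<epsilon> that unfolding sign_family_def by fastforce
  \<comment> \<open>The extension lemma counts from 0 and the directions from 1, hence the shift by
    \<open>Suc\<close>.\<close>
  have "\<exists>T. orthogonal_transformation T \<and> (\<forall>i<m. T (n (Suc i)) = \<epsilon> (Suc i) *\<^sub>R n' (Suc i))"
  proof (rule orthogonal_transformation_of_gram_eq)
    fix i j assume "i < m" "j < m"
    then have ij: "Suc i \<in> {1..m}" "Suc j \<in> {1..m}" by auto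
    have "\<epsilon> (Suc i) * \<epsilon> (Suc j) * (n' (Suc i) \<bullet> n' (Suc j))
        = (\<epsilon> (Suc i) * \<epsilon> (Suc i)) * (\<epsilon> (Suc j) * \<epsilon> (Suc j)) * (n (Suc i) \<bullet> n (Suc j))"
      unfolding G[OF ij] by (simp only: mult_ac)
    then show "n (Suc i) \<bullet> n (Suc j) = (\<epsilon> (Suc i) *\<^sub>R n' (Suc i)) \<bullet> (\<epsilon> (Suc j) *\<^sub>R n' (Suc j))"
      by (simp add: sq[OF ij(1)] sq[OF ij(2)] mult_ac)
  qed
  then obtain T where T: "orthogonal_transformation T"
    and Tn: "\<And>i. i < m \<Longrightarrow> T (n (Suc i)) = \<epsilon> (Suc i) *\<^sub>R n' (Suc i)"
    by blast
  have "n' i = \<epsilon> i *\<^sub>R (matrix T *v n i)" if i: "i \<in> {1..m}" for i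
  proof -
    obtain k where k: "i = Suc k" "k < m" using i by (cases i) auto
    have "matrix T *v n i = T (n i)"
      using T by (simp add: matrix_works orthogonal_transformation_linear)
    then show ?thesis
      using Tn[OF k(2)] sq[OF i] k(1) by simp
  qed
  moreover have "orthogonal_matrix (matrix T)"
    using T by (simp add: orthogonal_transformation_matrix)
  ultimately show "same_config m n n'"
    using \<epsilon> by (auto simp: same_config_def)
qed

section \<open>Sign potentials on the correlation graph\<close>

text \<open>
  The potential at a vertex is the value of \<open>s\<close> on an edge vector joining it to the
  representative of its component; the value does not depend on the edge vector because \<open>s\<close>
  vanishes on cycles.
\<close>

lemma coboundary_of_vanishing_on_cycles:
  fixes s :: "nat set \<Rightarrow> bit"
  assumes V: "finite V" and E: "E \<subseteq> {{u, v} | u v. u \<in> V \<and> v \<in> V \<and> u \<noteq> v}"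
    and vanish: "\<And>x. x \<in> cycle_space V E \<Longrightarrow> (\<Sum>e\<in>E. s e * x e) = 0"
  obtains p :: "nat \<Rightarrow> bit" where "\<And>u v. {u, v} \<in> E \<Longrightarrow> s {u, v} = p u + p v"
proof -
  have fin: "finite E"
    by (rule finite_subset[of _ "Pow V"]) (use V E in auto)
  \<comment> \<open>Edge vectors with boundary u + v, that is, paths from \<open>u\<close> to
    \<open>v\<close> up to cycles. For \<open>u = v\<close> the two indicators cancel and the cycle
    space remains.\<close>
  define W :: "nat \<Rightarrow> nat \<Rightarrow> (nat set \<Rightarrow> bit) set" where
    "W u v = {x. (\<forall>e. e \<notin> E \<longrightarrow> x e = 0) \<and>
      (\<forall>w\<in>V. (\<Sum>e | e \<in> E \<and> w \<in> e. x e) = of_bool (w = u) + of_bool (w = v))}" for u v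
  define L where "L x = (\<Sum>e\<in>E. s e * x e)" for x
  have bit2: "b + b = 0" for b :: bit
    by (cases b) simp_all
  have L_add: "L (\<lambda>e. x e + y e) = L x + L y" for x y
    by (simp add: L_def distrib_left sum.distrib del: add_bit_eq_xor mult_bit_eq_and)
  have W_add: "(\<lambda>e. x e + y e) \<in> W u w" if "x \<in> W u v" "y \<in> W v w" for x y u v w
  proof -
    have "a + b + (b + c) = a + c" for a b c :: bit
      by (cases a; cases b; cases c) simp_all
    then show ?thesis
      using that by (simp add: W_def sum.distrib del: add_bit_eq_xor)
  qed
  have W_sym: "W u v = W v u" for u v
    by (simp add: W_def add.commute del: add_bit_eq_xor)
  have W_cycle: "W u u = cycle_space V E" for u
    by (simp add: W_def cycle_space_def bit2 del: add_bit_eq_xor)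
  have W_refl: "(\<lambda>e. 0) \<in> W u u" for u
    by (simp add: W_cycle cycle_space_def)
  \<comment> \<open>Over the two-element field the sum of two vectors with the same boundary is a
    cycle.\<close>
  have L_unique: "L x = L y" if "x \<in> W u v" "y \<in> W u v" for x y u v
  proof -
    have "L x + L y = 0"
      using vanish[of "\<lambda>e. x e + y e"] W_add[of x u v y u] that
      by (simp add: W_sym[of v u] W_cycle L_add[symmetric] L_def[symmetric] del: add_bit_eq_xor mult_bit_eq_and)
    then show ?thesis
      by (cases "L x"; cases "L y") simp_all
  qed
  have W_edge: "edge_vec {{u, v}} \<in> W u v" and L_edge: "L (edge_vec {{u, v}}) = s {u, v}"
    if uv: "{u, v} \<in> E" for u v
  proof -
    have ne: "u \<noteq> v"
      using uv E by (auto simp: doubleton_eq_iff)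
    have "(\<Sum>e | e \<in> E \<and> w \<in> e. edge_vec {{u, v}} e) = of_bool (w = u) + of_bool (w = v)" for w
    proof -
      have "(\<Sum>e | e \<in> E \<and> w \<in> e. edge_vec {{u, v}} e) = (\<Sum>e\<in>(if w \<in> {u, v} then {{u, v}} else {}). 1)"
        using fin uv by (intro sum.mono_neutral_cong_right) (auto simp: edge_vec_def split: if_splits)
      then show ?thesis
        using ne by auto
    qed
    then show "edge_vec {{u, v}} \<in> W u v"
      using uv by (auto simp: W_def edge_vec_def simp del: add_bit_eq_xor)
    have "L (edge_vec {{u, v}}) = (\<Sum>e\<in>{{u, v}}. s e)"
      unfolding L_def using fin uv
      by (intro sum.mono_neutral_cong_right) (auto simp: edge_vec_def simp del: mult_bit_eq_and)
    then show "L (edge_vec {{u, v}}) = s {u, v}" by simp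
  qed
  define r where "r v = (LEAST u. W u v \<noteq> {})" for v
  have r_ne: "W (r v) v \<noteq> {}" for v
    unfolding r_def by (rule LeastI[where k = v]) (use W_refl in blast)
  \<comment> \<open>Adding the edge converts vectors ending at \<open>u\<close> into vectors ending
    at \<open>v\<close> and back, so adjacent vertices have the same least representative.\<close>
  have r_eq: "r u = r v" if "{u, v} \<in> E" for u v
  proof -
    have "W w u \<noteq> {} \<longleftrightarrow> W w v \<noteq> {}" for w
      using W_edge[OF that] W_add W_sym by (metis ex_in_conv)
    then show ?thesis by (simp add: r_def)
  qed
  define p where "p v = L (SOME x. x \<in> W (r v) v)" for v
  have p: "p v = L x" if "x \<in> W (r v) v" for x v
    unfolding p_def using someI[of "\<lambda>x. x \<in> W (r v) v", OF that] that by (rule L_unique)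
  have "s {u, v} = p u + p v" if uv: "{u, v} \<in> E" for u v
  proof -
    obtain x where x: "x \<in> W (r u) u" using r_ne by blast
    have "(\<lambda>e. x e + edge_vec {{u, v}} e) \<in> W (r v) v"
      using W_add[OF x W_edge[OF uv]] r_eq[OF uv] by simp
    then have "p v = p u + s {u, v}"
      using p[OF x] p L_add L_edge[OF uv] by simp
    then show ?thesis
      by (cases "p u"; cases "s {u, v}") simp_all
  qed
  then show ?thesis by (rule that)
qed

section \<open>From moment data to the Gram matrix up to signs\<close>

lemma abs_gram_eq_of_same_data:
  assumes unit: "\<forall>i\<in>{1..m}. norm (n i) = 1" and unit': "\<forall>i\<in>{1..m}. norm (n' i) = 1"
    and data: "same_data (pair_labels m \<union> L) n n'" and ij: "i \<in> {1..m}" "j \<in> {1..m}"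
  shows "\<bar>n i \<bullet> n j\<bar> = \<bar>n' i \<bullet> n' j\<bar>"
proof -
  have *: "\<bar>n i \<bullet> n j\<bar> = \<bar>n' i \<bullet> n' j\<bar>" if "i < j" "i \<in> {1..m}" "j \<in> {1..m}" for i j
  proof (rule abs_inner_eq_of_abs_moment_eq)
    have "[i, j] \<in> pair_labels m"
      using that by (auto simp: pair_labels_def)
    then show "abs_moment [n i, n j] = abs_moment [n' i, n' j]"
      using data by (force simp: same_data_def)
  qed (use that unit unit' in auto)
  show ?thesis
  proof (cases i j rule: linorder_cases)
    case equal
    then show ?thesis using unit unit' ij by (simp add: norm_eq_1)
  qed (use *[of i j] *[of j i] ij in \<open>simp_all add: inner_commute\<close>)
qed

text \<open>The label set \<open>L\<close> is left open to serve both the full triple data and the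
  triples through the reference index.\<close>

lemma gram_triple_eq_of_same_data:
  assumes unit: "\<forall>i\<in>{1..m}. norm (n i) = 1" and unit': "\<forall>i\<in>{1..m}. norm (n' i) = 1"
    and data: "same_data (pair_labels m \<union> L) n n'"
    and ijk: "i \<in> {1..m}" "j \<in> {1..m}" "k \<in> {1..m}" "[i, j, k] \<in> L"
  shows "(n i \<bullet> n j) * (n i \<bullet> n k) * (n j \<bullet> n k) = (n' i \<bullet> n' j) * (n' i \<bullet> n' k) * (n' j \<bullet> n' k)"
proof (rule inner_prod_eq_of_abs_moment_eq)
  show "abs_moment [n i, n j, n k] = abs_moment [n' i, n' j, n' k]"
    using data ijk(4) by (force simp: same_data_def)
qed (use unit unit' ijk abs_gram_eq_of_same_data[OF unit unit' data] in auto)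

text \<open>Labels are increasing lists, whereas triangles come in any order; the product is
  symmetric in the three indices, so all six orders reduce to the sorted one.\<close>

lemma gram_triple_eq_of_same_triple_data:
  assumes unit: "\<forall>i\<in>{1..m}. norm (n i) = 1" and unit': "\<forall>i\<in>{1..m}. norm (n' i) = 1"
    and data: "same_data (pair_labels m \<union> triple_labels m) n n'"
    and ijk: "i \<in> {1..m}" "j \<in> {1..m}" "k \<in> {1..m}" and ne: "i \<noteq> j" "j \<noteq> k" "i \<noteq> k"
  shows "(n i \<bullet> n j) * (n i \<bullet> n k) * (n j \<bullet> n k) = (n' i \<bullet> n' j) * (n' i \<bullet> n' k) * (n' j \<bullet> n' k)"
proof -
  have *: "(n i \<bullet> n j) * (n i \<bullet> n k) * (n j \<bullet> n k) = (n' i \<bullet> n' j) * (n' i \<bullet> n' k) * (n' j \<bullet> n' k)"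
    if "i \<in> {1..m}" "j \<in> {1..m}" "k \<in> {1..m}" "i < j" "j < k" for i j k
    using that by (intro gram_triple_eq_of_same_data[OF unit unit' data]) (auto simp: triple_labels_def)
  consider "i < j" "j < k" | "i < k" "k < j" | "j < i" "i < k" | "j < k" "k < i" | "k < i" "i < j" | "k < j" "j < i"
    using ne by linarith
  then show ?thesis
    by cases (use *[of i j k] *[of i k j] *[of j i k] *[of j k i] *[of k i j] *[of k j i] ijk
      in \<open>simp_all add: inner_commute mult_ac\<close>)
qed

lemma doubleton_in_corr_edges_iff:
  "{i, j} \<in> corr_edges m n \<longleftrightarrow> i \<in> {1..m} \<and> j \<in> {1..m} \<and> i \<noteq> j \<and> n i \<bullet> n j \<noteq> 0"
  by (auto simp: corr_edges_def doubleton_eq_iff inner_commute)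

lemma sign_conjugate_of_triangles_generate:
  assumes unit: "\<forall>i\<in>{1..m}. norm (n i) = 1" and unit': "\<forall>i\<in>{1..m}. norm (n' i) = 1"
    and data: "same_data (pair_labels m \<union> triple_labels m) n n'"
    and gen: "triangle_space (corr_edges m n) = cycle_space {1..m} (corr_edges m n)"
  shows "sign_conjugate m (gram n) (gram n')"
proof -
  let ?E = "corr_edges m n"
  \<comment> \<open>The value 1 marks entries that differ, which on edges means a change of sign.
    Symmetry of the inner product makes this a function of the unordered pair.\<close>
  define s :: "nat set \<Rightarrow> bit" where
    "s e = of_bool (\<exists>i j. e = {i, j} \<and> n i \<bullet> n j \<noteq> n' i \<bullet> n' j)" for e
  have s: "s {i, j} = of_bool (n i \<bullet> n j \<noteq> n' i \<bullet> n' j)" for i j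
    by (auto simp: s_def doubleton_eq_iff inner_commute)
  note abs = abs_gram_eq_of_same_data[OF unit unit' data]
  have E: "?E \<subseteq> {{u, v} | u v. u \<in> {1..m} \<and> v \<in> {1..m} \<and> u \<noteq> v}"
    by (auto simp: corr_edges_def)
  have fin: "finite ?E"
    by (rule finite_subset[of _ "Pow {1..m}"]) (use E in auto)
  have "triangle_space ?E \<subseteq> {x. (\<Sum>e\<in>?E. s e * x e) = 0}"
    unfolding triangle_space_def
  proof (rule edge_space.span_minimal)
    show "edge_space.subspace {x. (\<Sum>e\<in>?E. s e * x e) = 0}"
    proof (rule edge_space.subspaceI)
      fix x y assume "x \<in> {x. (\<Sum>e\<in>?E. s e * x e) = 0}" "y \<in> {x. (\<Sum>e\<in>?E. s e * x e) = 0}"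
      then show "x + y \<in> {x. (\<Sum>e\<in>?E. s e * x e) = 0}"
        by (simp add: distrib_left sum.distrib del: add_bit_eq_xor mult_bit_eq_and)
    next
      fix c x assume "x \<in> {x. (\<Sum>e\<in>?E. s e * x e) = 0}"
      then show "edge_scale c x \<in> {x. (\<Sum>e\<in>?E. s e * x e) = 0}"
        by (cases c) (simp_all add: edge_scale_def del: mult_bit_eq_and)
    qed (simp del: mult_bit_eq_and)
    show "edge_vec ` triangles ?E \<subseteq> {x. (\<Sum>e\<in>?E. s e * x e) = 0}"
    proof clarify
      fix t assume "t \<in> triangles ?E"
      then obtain a b c where t: "t = {{a, b}, {b, c}, {a, c}}"
        and ne: "a \<noteq> b" "b \<noteq> c" "a \<noteq> c" and tE: "{a, b} \<in> ?E" "{b, c} \<in> ?E" "{a, c} \<in> ?E"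
        by (auto simp: triangles_def)
      have "(\<Sum>e\<in>?E. s e * edge_vec t e) = (\<Sum>e\<in>t. s e)"
        using fin tE unfolding t
        by (intro sum.mono_neutral_cong_right) (auto simp: edge_vec_def simp del: mult_bit_eq_and)
      also have "\<dots> = s {a, b} + (s {b, c} + s {a, c})"
        using ne unfolding t by (subst sum.insert; simp add: doubleton_eq_iff del: add_bit_eq_xor)+
      \<comment> \<open>The product around the triangle is nonzero and preserved, so an even number
        of its three entries changes sign.\<close>
      also have "\<dots> = 0"
      proof -
        have abc: "a \<in> {1..m}" "b \<in> {1..m}" "c \<in> {1..m}"
          and nz: "n a \<bullet> n b \<noteq> 0" "n b \<bullet> n c \<noteq> 0" "n a \<bullet> n c \<noteq> 0"
          using tE by (auto simp: doubleton_in_corr_edges_iff)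
        have prod: "(n a \<bullet> n b) * (n a \<bullet> n c) * (n b \<bullet> n c) = (n' a \<bullet> n' b) * (n' a \<bullet> n' c) * (n' b \<bullet> n' c)"
          by (rule gram_triple_eq_of_same_triple_data[OF unit unit' data abc ne])
        have "n' a \<bullet> n' b = n a \<bullet> n b \<or> n' a \<bullet> n' b = - (n a \<bullet> n b)"
          "n' a \<bullet> n' c = n a \<bullet> n c \<or> n' a \<bullet> n' c = - (n a \<bullet> n c)"
          "n' b \<bullet> n' c = n b \<bullet> n c \<or> n' b \<bullet> n' c = - (n b \<bullet> n c)"
          using abs[of a b] abs[of a c] abs[of b c] abc by (auto simp: abs_eq_iff)
        then show ?thesis
          using prod nz by (elim disjE) (simp_all add: s)
      qed
      finally show "(\<Sum>e\<in>?E. s e * edge_vec t e) = 0" .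
    qed
  qed
  then have "(\<Sum>e\<in>?E. s e * x e) = 0" if "x \<in> cycle_space {1..m} ?E" for x
    using that gen by auto
  then obtain p where p: "\<And>u v. {u, v} \<in> ?E \<Longrightarrow> s {u, v} = p u + p v"
    using coboundary_of_vanishing_on_cycles[OF _ E, of s] by blast
  define \<epsilon> :: "nat \<Rightarrow> real" where "\<epsilon> i = (if p i = 0 then 1 else -1)" for i
  have "n' i \<bullet> n' j = \<epsilon> i * (n i \<bullet> n j) * \<epsilon> j" if ij: "i \<in> {1..m}" "j \<in> {1..m}" for i j
  proof -
    have or: "n' i \<bullet> n' j = n i \<bullet> n j \<or> n' i \<bullet> n' j = - (n i \<bullet> n j)"
      using abs[of i j] ij by (auto simp: abs_eq_iff)
    \<comment> \<open>Off the edges nothing depends on the potential: diagonal entries are 1, and an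
      orthogonal pair stays orthogonal because absolute values agree.\<close>
    consider "i = j" | "n i \<bullet> n j = 0" | "{i, j} \<in> ?E"
      using ij doubleton_in_corr_edges_iff by blast
    then show ?thesis
    proof cases
      case 1
      then show ?thesis using unit unit' ij by (simp add: norm_eq_1 \<epsilon>_def)
    next
      case 2
      then show ?thesis using or by auto
    next
      case 3
      then have "n i \<bullet> n j \<noteq> 0"
        by (simp add: doubleton_in_corr_edges_iff)
      with or p[OF 3] show ?thesis
        by (cases "p i"; cases "p j") (auto simp: \<epsilon>_def s split: if_splits)
    qed
  qed
  moreover have "sign_family m \<epsilon>"
    by (simp add: sign_family_def \<epsilon>_def)
  ultimately show ?thesis
    unfolding sign_conjugate_def gram_def by blast
qed

text \<open>The signs are chosen so that the row of the reference direction matches. In a triangle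
  through index 1 the two entries of that row are nonzero and can be cancelled, which determines the
  third entry.\<close>

lemma sign_conjugate_of_complete:
  assumes unit: "\<forall>i\<in>{1..m}. norm (n i) = 1" and unit': "\<forall>i\<in>{1..m}. norm (n' i) = 1"
    and data: "same_data (pair_labels m \<union> ref_triple_labels m) n n'" and m: "1 \<le> m"
    and nz: "\<And>i. i \<in> {1..m} \<Longrightarrow> n 1 \<bullet> n i \<noteq> 0"
  shows "sign_conjugate m (gram n) (gram n')"
proof -
  define \<epsilon> :: "nat \<Rightarrow> real" where "\<epsilon> i = (if n' 1 \<bullet> n' i = n 1 \<bullet> n i then 1 else -1)" for i
  have \<epsilon>_sq: "\<epsilon> i * \<epsilon> i = 1" for i
    by (simp add: \<epsilon>_def)
  have \<epsilon>1: "\<epsilon> 1 = 1"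
    using unit unit' m by (simp add: \<epsilon>_def norm_eq_1)
  have row: "n' 1 \<bullet> n' i = \<epsilon> i * (n 1 \<bullet> n i)" if "i \<in> {1..m}" for i
    using abs_gram_eq_of_same_data[OF unit unit' data, of 1 i] that m by (auto simp: \<epsilon>_def abs_eq_iff)
  have less: "n' i \<bullet> n' j = \<epsilon> i * (n i \<bullet> n j) * \<epsilon> j" if ij: "2 \<le> i" "i < j" "j \<le> m" for i j
  proof -
    have "(n 1 \<bullet> n i) * (n 1 \<bullet> n j) * (n i \<bullet> n j) = (n' 1 \<bullet> n' i) * (n' 1 \<bullet> n' j) * (n' i \<bullet> n' j)"
      using ij by (intro gram_triple_eq_of_same_data[OF unit unit' data]) (auto simp: ref_triple_labels_def)
    also have "\<dots> = (n 1 \<bullet> n i) * (n 1 \<bullet> n j) * (\<epsilon> i * \<epsilon> j * (n' i \<bullet> n' j))"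
      using ij row[of i] row[of j] by simp
    finally have "n i \<bullet> n j = \<epsilon> i * \<epsilon> j * (n' i \<bullet> n' j)"
      using ij nz[of i] nz[of j] by simp
    then have "\<epsilon> i * (n i \<bullet> n j) * \<epsilon> j = (\<epsilon> i * \<epsilon> i) * (\<epsilon> j * \<epsilon> j) * (n' i \<bullet> n' j)"
      by (simp only: mult_ac)
    then show ?thesis by (simp add: \<epsilon>_sq)
  qed
  have "n' i \<bullet> n' j = \<epsilon> i * (n i \<bullet> n j) * \<epsilon> j" if ij: "i \<in> {1..m}" "j \<in> {1..m}" for i j
  proof -
    consider "i = 1" | "j = 1" | "i = j" | "2 \<le> i" "i < j" | "2 \<le> j" "j < i"
      using ij by (fastforce simp: not_less_eq_eq)
    then show ?thesis
    proof cases
      case 1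
      then show ?thesis using row[OF ij(2)] \<epsilon>1 by simp
    next
      case 2
      then show ?thesis using row[OF ij(1)] \<epsilon>1 by (simp add: inner_commute)
    next
      case 3
      then show ?thesis using unit unit' ij \<epsilon>_sq[of j] by (simp add: norm_eq_1)
    next
      case 4
      then show ?thesis using less[of i j] ij by simp
    next
      case 5
      then show ?thesis using less[of j i] ij by (simp add: inner_commute mult_ac)
    qed
  qed
  moreover have "sign_family m \<epsilon>"
    by (simp add: sign_family_def \<epsilon>_def)
  ultimately show ?thesis
    unfolding sign_conjugate_def gram_def by blast
qed

section \<open>Counting the data labels\<close>

lemma card_increasing_pairs:
  "card {[i, j] | i j. a \<le> i \<and> i < j \<and> j \<le> (b::nat)} = card {a..b} choose 2"
proof -
  let ?B = "{B. B \<subseteq> {a..b} \<and> card B = 2}"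
  have sorted: "sorted_list_of_set {i, j} = [i, j]" if "i < j" for i j :: nat
    using that by (simp add: sorted_list_of_set_insert_remove)
  \<comment> \<open>Increasing two-element lists are the sorted enumerations of two-element sets;
    \<open>set\<close> inverts the enumeration.\<close>
  have "{[i, j] | i j. a \<le> i \<and> i < j \<and> j \<le> b} = sorted_list_of_set ` ?B"
  proof (intro set_eqI iffI)
    fix l assume "l \<in> {[i, j] | i j. a \<le> i \<and> i < j \<and> j \<le> b}"
    then obtain i j where "l = [i, j]" "a \<le> i" "i < j" "j \<le> b" by auto
    then show "l \<in> sorted_list_of_set ` ?B"
      using sorted[of i j] by (intro image_eqI[of _ _ "{i, j}"]) auto
  next
    fix l assume "l \<in> sorted_list_of_set ` ?B"
    then obtain B where l: "l = sorted_list_of_set B" and B: "B \<subseteq> {a..b}" "card B = 2"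
      by auto
    then obtain i j where "B = {i, j}" "i < j"
      by (metis card_2_iff insert_commute linorder_neqE_nat)
    then show "l \<in> {[i, j] | i j. a \<le> i \<and> i < j \<and> j \<le> b}"
      using B(1) l sorted[of i j] by auto
  qed
  moreover have "inj_on sorted_list_of_set ?B"
    by (rule inj_on_inverseI[of _ set]) (metis (mono_tags, lifting) finite_atLeastAtMost finite_subset mem_Collect_eq set_sorted_list_of_set)
  ultimately show ?thesis
    by (simp add: card_image n_subsets)
qed

text \<open>Pair and triple labels are disjoint because their lengths differ. Deleting the leading 1
  turns reference triples into increasing pairs from \<open>{2..m}\<close>.\<close>

lemma card_pair_ref_triple_labels:
  "card (pair_labels m \<union> ref_triple_labels m) = (m choose 2) + ((m - 1) choose 2)"
proof -
  have ref: "ref_triple_labels m = Cons 1 ` {[i, j] | i j. 2 \<le> i \<and> i < j \<and> j \<le> m}"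
    by (auto simp: ref_triple_labels_def)
  have "finite (pair_labels m)" "finite (ref_triple_labels m)"
    unfolding pair_labels_def ref_triple_labels_def
    by (rule finite_subset[OF _ finite_lists_length_le[of "{..m}" 3]]; auto)+
  moreover have "pair_labels m \<inter> ref_triple_labels m = {}"
    by (auto simp: pair_labels_def ref_triple_labels_def)
  moreover have "card (pair_labels m) = m choose 2"
    unfolding pair_labels_def card_increasing_pairs by simp
  moreover have "card (ref_triple_labels m) = (m - 1) choose 2"
    unfolding ref by (subst card_image) (simp_all add: card_increasing_pairs Suc_diff_le)
  ultimately show ?thesis
    by (simp add: card_Un_disjoint)
qed

lemma choose_two_add_choose_two_pred:
  assumes "1 \<le> m"
  shows "(m choose 2) + ((m - 1) choose 2) = (m - 1)\<^sup>2"
proof -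
  have "(Suc k choose 2) + (k choose 2) = k\<^sup>2" for k
    by (induction k) (simp_all add: numeral_2_eq_2)
  then show ?thesis
    using assms by (cases m) simp_all
qed

theorem theorem7p3:
  fixes m :: nat and n :: "nat \<Rightarrow> real^3"
  assumes unit: "\<forall>i\<in>{1..m}. n i \<in> sphere 0 1"
    and nonparallel: "\<forall>i\<in>{1..m}. \<forall>j\<in>{1..m}. i \<noteq> j \<longrightarrow> n i \<noteq> n j \<and> n i \<noteq> - n j"
  shows
    "(triangle_space (corr_edges m n) = cycle_space {1..m} (corr_edges m n) \<longrightarrow>
        (\<forall>n'. (\<forall>i\<in>{1..m}. n' i \<in> sphere 0 1) \<and> same_data (pair_labels m \<union> triple_labels m) n n' \<longrightarrow>
           same_config m n n' \<and> sign_conjugate m (gram n) (gram n'))) \<and>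
     (\<forall>n'. (\<forall>i\<in>{1..m}. n' i \<in> sphere 0 1) \<longrightarrow>
           (same_config m n n' \<longleftrightarrow> sign_conjugate m (gram n) (gram n'))) \<and>
     (1 \<le> m \<and> (\<forall>i\<in>{1..m}. \<forall>j\<in>{1..m}. i \<noteq> j \<longrightarrow> {i, j} \<in> corr_edges m n) \<longrightarrow>
        (\<forall>n'. (\<forall>i\<in>{1..m}. n' i \<in> sphere 0 1) \<and> same_data (pair_labels m \<union> ref_triple_labels m) n n' \<longrightarrow>
           same_config m n n' \<and> sign_conjugate m (gram n) (gram n')) \<and>
        card (pair_labels m \<union> ref_triple_labels m) = (m choose 2) + ((m - 1) choose 2) \<and>
        (m choose 2) + ((m - 1) choose 2) = (m - 1)\<^sup>2)"
proof (intro conjI impI allI)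
  have unit_norm: "\<forall>i\<in>{1..m}. norm (f i) = 1" if "\<forall>i\<in>{1..m}. f i \<in> sphere 0 1" for f :: "nat \<Rightarrow> real^3"
    using that by simp
  note unit = unit_norm[OF assms(1)]
  show "same_config m n n' \<longleftrightarrow> sign_conjugate m (gram n) (gram n')" for n'
    by (rule same_config_iff_sign_conjugate)
  {
    fix n' assume gen: "triangle_space (corr_edges m n) = cycle_space {1..m} (corr_edges m n)"
      and *: "(\<forall>i\<in>{1..m}. n' i \<in> sphere 0 1) \<and> same_data (pair_labels m \<union> triple_labels m) n n'"
    show "sign_conjugate m (gram n) (gram n')"
      using * gen by (intro sign_conjugate_of_triangles_generate[OF unit unit_norm]) auto
    then show "same_config m n n'"
      by (simp add: same_config_iff_sign_conjugate)
  }
  assume complete: "1 \<le> m \<and> (\<forall>i\<in>{1..m}. \<forall>j\<in>{1..m}. i \<noteq> j \<longrightarrow> {i, j} \<in> corr_edges m n)"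
  \<comment> \<open>Completeness concerns distinct indices; the diagonal entries are 1, so the whole
    reference row is nonzero, including its first entry.\<close>
  then have "n i \<bullet> n j \<noteq> 0" if "i \<in> {1..m}" "j \<in> {1..m}" for i j
    using that unit by (cases "i = j") (auto simp: doubleton_in_corr_edges_iff norm_eq_1)
  then have nz: "n 1 \<bullet> n i \<noteq> 0" if "i \<in> {1..m}" for i
    using that complete by simp
  {
    fix n' assume *: "(\<forall>i\<in>{1..m}. n' i \<in> sphere 0 1) \<and> same_data (pair_labels m \<union> ref_triple_labels m) n n'"
    show "sign_conjugate m (gram n) (gram n')"
      using * complete nz by (intro sign_conjugate_of_complete[OF unit unit_norm]) auto
    then show "same_config m n n'"
      by (simp add: same_config_iff_sign_conjugate)
  }
  show "card (pair_labels m \<union> ref_triple_labels m) = (m choose 2) + ((m - 1) choose 2)"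
    by (rule card_pair_ref_triple_labels)
  show "(m choose 2) + ((m - 1) choose 2) = (m - 1)\<^sup>2"
    using complete by (intro choose_two_add_choose_two_pred) simp
qed

end
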